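(* Let $\mathcal S=(M,\Delta,\langle\cdot,\cdot\rangle)$ be a contact sub-Riemannian surface, let $\eta=\{\eta^1,\eta^2,\eta^3\}$ be an adapted coframe field on a neighborhood $U$ of a point $p\in M$ satisfying $$d\eta^1=C^1_{23}\,\eta^2\wedge\eta^3+C^1_{31}\,\eta^3\wedge\eta^1+C^1_{12}\,\eta^1\wedge\eta^2,$$ $$d\eta^2=C^2_{23}\,\eta^2\wedge\eta^3+C^2_{31}\,\eta^3\wedge\eta^1+C^2_{12}\,\eta^1\wedge\eta^2,\qquad d\eta^3=\eta^1\wedge\eta^2$$ for some functions $C^a_{bc}$ on $U$, and let $\{E_1,E_2,E_3\}$ be the dual frame field. a) For any infinitesimal symmetry $V$ of $\mathcal S$ there exists a unique function $f:U\to\mathbb R$ such that $$V=-E_2(f)E_1+E_1(f)E_2+fE_3\quad\text{and}\quad E_3f=0 .$$ b) Let $$\mathcal M=\Big(\tfrac{C^1_{23}-C^2_{31}}{2}\Big)^2+(C^1_{31})^2,\qquad \mathcal K=E_1C^2_{12}-E_2C^1_{12}+(C^1_{12})^2+(C^2_{12})^2-\tfrac12(C^1_{23}+C^2_{31}).$$ If $V$ is transversal to $\Delta$ and $E_1\mathcal K\,E_2\mathcal M-E_2\mathcal K\,E_1\mathcal M\neq0$, then the function $f$ from a) satisfies $$E_1(\ln f)=\frac{E_3\mathcal K\,E_1\mathcal M-E_1\mathcal K\,E_3\mathcal M}{E_1\mathcal K\,E_2\mathcal M-E_2\mathcal K\,E_1\mathcal M},\qquad E_2(\ln f)=\frac{E_3\mathcal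 K\,E_2\mathcal M-E_2\mathcal K\,E_3\mathcal M}{E_1\mathcal K\,E_2\mathcal M-E_2\mathcal K\,E_1\mathcal M},\qquad E_3(\ln f)=0 .$$
   Context: All objects are smooth. A sub-Riemannian surface $\mathcal S=(M,\Delta,\langle\cdot,\cdot\rangle)$ is a 3-dimensional oriented manifold $M$ with an oriented rank-2 distribution $\Delta\subset TM$ carrying a (positive definite) metric tensor $\langle\cdot,\cdot\rangle_p$ on each $\Delta_p$. It is contact if locally $\Delta=\ker\omega$ for a 1-form $\omega$ with $\omega\wedge d\omega$ nowhere zero. A coframe $(\eta^1,\eta^2,\eta^3)$ of $T_pM$ is adapted to $\mathcal S$ if $(\eta^1|_{\Delta_p},\eta^2|_{\Delta_p})$ is a positively oriented coframe of $\Delta_p$, $\eta^3$ vanishes on $\Delta_p$, and $\langle W,W\rangle=\eta^1(W)^2+\eta^2(W)^2$ for all $W\in\Delta_p$. A symmetry of $\mathcal S$ is a local diffeomorphism $F$ of $M$ with $dF(\Delta_p)=\Delta_{F(p)}$ and $\langle dF(W),dF(W)\rangle_{F(p)}=\langle W,W\rangle_p$ for all $W\in\Delta_p$. A vector field $V$ on $M$ is an infinitesimal symmetry if its (local) flow consists of symmetries. In b), transversality of $V$ to $\Delta$ (i.e. $V_q\notin\Delta_q$) and the inequality are understood at every point of $U$; then $f$ is nowhere zero, and $E_i(\ln f)$ means $E_i(f)/f$ (i.e. $\ln f$ is read as $\ln|f|$). *)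

theory Defs
  imports "HOL-Analysis.Analysis"
begin

text \<open>
  \<open>Ck_on k f S\<close> is meant for open \<open>S\<close> and finite-dimensional domains, where it says that \<open>f\<close>
  is \<open>k\<close> times continuously differentiable on \<open>S\<close>.
\<close>

primrec Ck_on ::
  "nat \<Rightarrow> ('v::real_normed_vector \<Rightarrow> 'w::real_normed_vector) \<Rightarrow> 'v set \<Rightarrow> bool" where
  "Ck_on 0 f S \<longleftrightarrow> continuous_on S f"
| "Ck_on (Suc k) f S \<longleftrightarrow>
     (\<forall>x\<in>S. f differentiable (at x)) \<and>
     (\<forall>v. Ck_on k (\<lambda>x. frechet_derivative f (at x) v) S)"

definition smooth_on ::
  "('v::real_normed_vector \<Rightarrow> 'w::real_normed_vector) \<Rightarrow> 'v set \<Rightarrow> bool" where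
  "smooth_on f S \<longleftrightarrow> (\<forall>k. Ck_on k f S)"


section \<open>Oriented 3-manifolds\<close>

text \<open>
  The underlying space of the manifold is the whole type \<open>'a\<close>; a chart is a pair of its domain and
  its coordinate map.  The orientation of the manifold is encoded by the positivity of the Jacobians
  of all transition maps of the given atlas.
\<close>

type_synonym 'a chart = "'a set \<times> ('a \<Rightarrow> real^3)"

abbreviation dom_chart :: "'a chart \<Rightarrow> 'a set" where
  "dom_chart c \<equiv> fst c"

abbreviation coord :: "'a chart \<Rightarrow> 'a \<Rightarrow> real^3" where
  "coord c \<equiv> snd c"

definition inv_chart :: "'a chart \<Rightarrow> real^3 \<Rightarrow> 'a" where
  "inv_chart c = inv_into (dom_chart c) (coord c)"

definition is_chart :: "'a::topological_space chart \<Rightarrow> bool" where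
  "is_chart c \<longleftrightarrow> open (dom_chart c) \<and> open (coord c ` dom_chart c) \<and>
     homeomorphism (dom_chart c) (coord c ` dom_chart c) (coord c) (inv_chart c)"

definition oriented_manifold3 ::
  "'a::{t2_space, second_countable_topology} chart set \<Rightarrow> bool" where
  "oriented_manifold3 A \<longleftrightarrow>
     (\<forall>c\<in>A. is_chart c) \<and> (\<Union>c\<in>A. dom_chart c) = UNIV \<and>
     (\<forall>b\<in>A. \<forall>c\<in>A.
        smooth_on (coord c \<circ> inv_chart b) (coord b ` (dom_chart b \<inter> dom_chart c)) \<and>
        (\<forall>x \<in> coord b ` (dom_chart b \<inter> dom_chart c).
           0 < det (matrix (frechet_derivative (coord c \<circ> inv_chart b) (at x)))))"


section \<open>Tangent vectors, functions, maps and forms\<close>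

text \<open>
  The tangent space at \<open>q\<close> is modelled as \<open>real^3\<close>: a vector stands for the tangent vector
  having it as its components in a chart around \<open>q\<close> that is chosen once and for all,
  \<open>pchart A q\<close>.  As this chart may jump from point to point, smoothness of
  vector fields and forms is expressed by their components in each fixed chart of the atlas;
  \<open>tchange b c q\<close> converts components at \<open>q\<close> in the chart \<open>b\<close> to components in the chart \<open>c\<close>.
\<close>

definition pchart :: "'a chart set \<Rightarrow> 'a \<Rightarrow> 'a chart" where
  "pchart A q = (SOME c. c \<in> A \<and> q \<in> dom_chart c)"

definition tchange :: "'a chart \<Rightarrow> 'a chart \<Rightarrow> 'a \<Rightarrow> real^3 \<Rightarrow> real^3" where
  "tchange b c q = frechet_derivative (coord c \<circ> inv_chart b) (at (coord b q))"

type_synonym 'a vfield = "'a \<Rightarrow> real^3"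
type_synonym 'a form1 = "'a \<Rightarrow> real^3 \<Rightarrow> real"
type_synonym 'a form2 = "'a \<Rightarrow> real^3 \<Rightarrow> real^3 \<Rightarrow> real"

definition smooth_fun :: "'a chart set \<Rightarrow> 'a set \<Rightarrow> ('a \<Rightarrow> real) \<Rightarrow> bool" where
  "smooth_fun A U h \<longleftrightarrow>
     (\<forall>c\<in>A. smooth_on (h \<circ> inv_chart c) (coord c ` (U \<inter> dom_chart c)))"

definition vfield_rep :: "'a chart set \<Rightarrow> 'a chart \<Rightarrow> 'a vfield \<Rightarrow> real^3 \<Rightarrow> real^3" where
  "vfield_rep A c X x = (let q = inv_chart c x in tchange (pchart A q) c q (X q))"

definition smooth_vfield :: "'a chart set \<Rightarrow> 'a set \<Rightarrow> 'a vfield \<Rightarrow> bool" where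
  "smooth_vfield A U X \<longleftrightarrow>
     (\<forall>c\<in>A. smooth_on (vfield_rep A c X) (coord c ` (U \<inter> dom_chart c)))"

definition form1_rep :: "'a chart set \<Rightarrow> 'a chart \<Rightarrow> 'a form1 \<Rightarrow> real^3 \<Rightarrow> real^3 \<Rightarrow> real" where
  "form1_rep A c \<alpha> x w = (let q = inv_chart c x in \<alpha> q (tchange c (pchart A q) q w))"

definition smooth_form1 :: "'a chart set \<Rightarrow> 'a set \<Rightarrow> 'a form1 \<Rightarrow> bool" where
  "smooth_form1 A U \<alpha> \<longleftrightarrow>
     (\<forall>q\<in>U. linear (\<alpha> q)) \<and>
     (\<forall>c\<in>A. \<forall>w. smooth_on (\<lambda>x. form1_rep A c \<alpha> x w) (coord c ` (U \<inter> dom_chart c)))"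

definition smooth_map :: "'a::topological_space chart set \<Rightarrow> 'a set \<Rightarrow> ('a \<Rightarrow> 'a) \<Rightarrow> bool" where
  "smooth_map A W F \<longleftrightarrow> continuous_on W F \<and>
     (\<forall>b\<in>A. \<forall>c\<in>A. smooth_on (coord c \<circ> F \<circ> inv_chart b)
        (coord b ` {q \<in> W \<inter> dom_chart b. F q \<in> dom_chart c}))"

text \<open>\<open>vderiv A X h\<close> is the function \<open>X(h)\<close>, \<open>tangent_map A F q\<close> the differential of \<open>F\<close> at \<open>q\<close>.\<close>

definition vderiv :: "'a chart set \<Rightarrow> 'a vfield \<Rightarrow> ('a \<Rightarrow> real) \<Rightarrow> 'a \<Rightarrow> real" where
  "vderiv A X h q =
     (let c = pchart A q in frechet_derivative (h \<circ> inv_chart c) (at (coord c q)) (X q))"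

definition tangent_map :: "'a chart set \<Rightarrow> ('a \<Rightarrow> 'a) \<Rightarrow> 'a \<Rightarrow> real^3 \<Rightarrow> real^3" where
  "tangent_map A F q =
     (let b = pchart A q; c = pchart A (F q) in
        frechet_derivative (coord c \<circ> F \<circ> inv_chart b) (at (coord b q)))"

text \<open>
  Conventions: \<open>(\<alpha> \<and> \<beta>)(u,v) = \<alpha>(u) \<beta>(v) - \<alpha>(v) \<beta>(u)\<close>, and in coordinates
  \<open>d\<alpha>(u,v) = \<partial>\<^sub>u(\<alpha>(v)) - \<partial>\<^sub>v(\<alpha>(u))\<close> for constant \<open>u, v\<close>.
  The latter does not depend on the chart, so the chart \<open>pchart A q\<close> is used at \<open>q\<close>.
\<close>

definition wedge :: "'a form1 \<Rightarrow> 'a form1 \<Rightarrow> 'a form2" (infixl "\<and>\<^sub>1" 65) where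
  "(\<alpha> \<and>\<^sub>1 \<beta>) q u v = \<alpha> q u * \<beta> q v - \<alpha> q v * \<beta> q u"

definition wedge12 :: "'a form1 \<Rightarrow> 'a form2 \<Rightarrow> 'a \<Rightarrow> real^3 \<Rightarrow> real^3 \<Rightarrow> real^3 \<Rightarrow> real" where
  "wedge12 \<alpha> \<beta> q u v w = \<alpha> q u * \<beta> q v w + \<alpha> q v * \<beta> q w u + \<alpha> q w * \<beta> q u v"

definition ext_deriv :: "'a chart set \<Rightarrow> 'a form1 \<Rightarrow> 'a form2" where
  "ext_deriv A \<alpha> q u v =
     (let c = pchart A q in
        frechet_derivative (\<lambda>x. form1_rep A c \<alpha> x v) (at (coord c q)) u -
        frechet_derivative (\<lambda>x. form1_rep A c \<alpha> x u) (at (coord c q)) v)"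


section \<open>Contact sub-Riemannian surfaces\<close>

text \<open>
  \<open>ori q\<close> is the set of positively oriented bases of \<open>\<Delta> q\<close>.
\<close>

definition oriented_distribution2 ::
  "'a::topological_space chart set \<Rightarrow> ('a \<Rightarrow> (real^3) set) \<Rightarrow> ('a \<Rightarrow> ((real^3) \<times> (real^3)) set) \<Rightarrow> bool" where
  "oriented_distribution2 A \<Delta> ori \<longleftrightarrow>
     (\<forall>p. \<exists>W X Y. open W \<and> p \<in> W \<and> smooth_vfield A W X \<and> smooth_vfield A W Y \<and>
        (\<forall>q\<in>W. X q \<noteq> Y q \<and> independent {X q, Y q} \<and> \<Delta> q = span {X q, Y q} \<and>
           ori q = {(a *\<^sub>R X q + b *\<^sub>R Y q, c *\<^sub>R X q + d *\<^sub>R Y q) | a b c d. a * d - b * c > 0}))"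

definition metric_on_distribution ::
  "'a::topological_space chart set \<Rightarrow> ('a \<Rightarrow> (real^3) set) \<Rightarrow> ('a \<Rightarrow> real^3 \<Rightarrow> real^3 \<Rightarrow> real) \<Rightarrow> bool" where
  "metric_on_distribution A \<Delta> g \<longleftrightarrow>
     (\<forall>q. \<forall>u\<in>\<Delta> q. \<forall>v\<in>\<Delta> q.
        g q u v = g q v u \<and>
        (\<forall>w\<in>\<Delta> q. \<forall>a b. g q (a *\<^sub>R u + b *\<^sub>R v) w = a * g q u w + b * g q v w) \<and>
        (u \<noteq> 0 \<longrightarrow> g q u u > 0)) \<and>
     (\<forall>W X Y. open W \<and> smooth_vfield A W X \<and> smooth_vfield A W Y \<and>
        (\<forall>q\<in>W. X q \<in> \<Delta> q \<and> Y q \<in> \<Delta> q) \<longrightarrow> smooth_fun A W (\<lambda>q. g q (X q) (Y q)))"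

definition sub_riemannian_surface ::
  "'a::{t2_space, second_countable_topology} chart set \<Rightarrow> ('a \<Rightarrow> (real^3) set) \<Rightarrow>
   ('a \<Rightarrow> ((real^3) \<times> (real^3)) set) \<Rightarrow> ('a \<Rightarrow> real^3 \<Rightarrow> real^3 \<Rightarrow> real) \<Rightarrow> bool" where
  "sub_riemannian_surface A \<Delta> ori g \<longleftrightarrow>
     oriented_manifold3 A \<and> oriented_distribution2 A \<Delta> ori \<and> metric_on_distribution A \<Delta> g"

definition contact :: "'a::topological_space chart set \<Rightarrow> ('a \<Rightarrow> (real^3) set) \<Rightarrow> bool" where
  "contact A \<Delta> \<longleftrightarrow>
     (\<forall>p. \<exists>W \<omega>. open W \<and> p \<in> W \<and> smooth_form1 A W \<omega> \<and>
        (\<forall>q\<in>W. \<Delta> q = {v. \<omega> q v = 0} \<and> (\<exists>u v w. wedge12 \<omega> (ext_deriv A \<omega>) q u v w \<noteq> 0)))"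

definition adapted_coframe ::
  "('a \<Rightarrow> (real^3) set) \<Rightarrow> ('a \<Rightarrow> ((real^3) \<times> (real^3)) set) \<Rightarrow> ('a \<Rightarrow> real^3 \<Rightarrow> real^3 \<Rightarrow> real) \<Rightarrow>
   'a \<Rightarrow> (real^3 \<Rightarrow> real) \<Rightarrow> (real^3 \<Rightarrow> real) \<Rightarrow> (real^3 \<Rightarrow> real) \<Rightarrow> bool" where
  "adapted_coframe \<Delta> ori g q \<alpha>1 \<alpha>2 \<alpha>3 \<longleftrightarrow>
     linear \<alpha>1 \<and> linear \<alpha>2 \<and> linear \<alpha>3 \<and>
     (\<forall>a b c. (\<forall>v. a * \<alpha>1 v + b * \<alpha>2 v + c * \<alpha>3 v = 0) \<longrightarrow> a = 0 \<and> b = 0 \<and> c = 0) \<and>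
     (\<forall>(u, v) \<in> ori q. \<alpha>1 u * \<alpha>2 v - \<alpha>1 v * \<alpha>2 u > 0) \<and>
     (\<forall>w\<in>\<Delta> q. \<alpha>3 w = 0) \<and>
     (\<forall>w\<in>\<Delta> q. g q w w = (\<alpha>1 w)\<^sup>2 + (\<alpha>2 w)\<^sup>2)"

definition adapted_coframe_field ::
  "'a chart set \<Rightarrow> ('a \<Rightarrow> (real^3) set) \<Rightarrow> ('a \<Rightarrow> ((real^3) \<times> (real^3)) set) \<Rightarrow>
   ('a \<Rightarrow> real^3 \<Rightarrow> real^3 \<Rightarrow> real) \<Rightarrow> 'a set \<Rightarrow> 'a form1 \<Rightarrow> 'a form1 \<Rightarrow> 'a form1 \<Rightarrow> bool" where
  "adapted_coframe_field A \<Delta> ori g U \<eta>1 \<eta>2 \<eta>3 \<longleftrightarrow>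
     smooth_form1 A U \<eta>1 \<and> smooth_form1 A U \<eta>2 \<and> smooth_form1 A U \<eta>3 \<and>
     (\<forall>q\<in>U. adapted_coframe \<Delta> ori g q (\<eta>1 q) (\<eta>2 q) (\<eta>3 q))"

definition dual_frame_field ::
  "'a chart set \<Rightarrow> 'a set \<Rightarrow> 'a form1 \<Rightarrow> 'a form1 \<Rightarrow> 'a form1 \<Rightarrow>
   'a vfield \<Rightarrow> 'a vfield \<Rightarrow> 'a vfield \<Rightarrow> bool" where
  "dual_frame_field A U \<eta>1 \<eta>2 \<eta>3 E1 E2 E3 \<longleftrightarrow>
     smooth_vfield A U E1 \<and> smooth_vfield A U E2 \<and> smooth_vfield A U E3 \<and>
     (\<forall>q\<in>U. \<eta>1 q (E1 q) = 1 \<and> \<eta>1 q (E2 q) = 0 \<and> \<eta>1 q (E3 q) = 0 \<and>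
             \<eta>2 q (E1 q) = 0 \<and> \<eta>2 q (E2 q) = 1 \<and> \<eta>2 q (E3 q) = 0 \<and>
             \<eta>3 q (E1 q) = 0 \<and> \<eta>3 q (E2 q) = 0 \<and> \<eta>3 q (E3 q) = 1)"


section \<open>Symmetries and infinitesimal symmetries\<close>

text \<open>A local diffeomorphism is a diffeomorphism from an open set \<open>W\<close> onto an open set.\<close>

definition local_diffeo :: "'a::topological_space chart set \<Rightarrow> 'a set \<Rightarrow> ('a \<Rightarrow> 'a) \<Rightarrow> bool" where
  "local_diffeo A W F \<longleftrightarrow> open W \<and> open (F ` W) \<and> inj_on F W \<and>
     smooth_map A W F \<and> smooth_map A (F ` W) (inv_into W F)"

definition symmetry ::
  "'a::topological_space chart set \<Rightarrow> ('a \<Rightarrow> (real^3) set) \<Rightarrow>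
   ('a \<Rightarrow> real^3 \<Rightarrow> real^3 \<Rightarrow> real) \<Rightarrow> 'a set \<Rightarrow> ('a \<Rightarrow> 'a) \<Rightarrow> bool" where
  "symmetry A \<Delta> g W F \<longleftrightarrow> local_diffeo A W F \<and>
     (\<forall>q\<in>W. tangent_map A F q ` \<Delta> q = \<Delta> (F q) \<and>
        (\<forall>w\<in>\<Delta> q. g (F q) (tangent_map A F q w) (tangent_map A F q w) = g q w w))"

definition local_flow ::
  "'a::topological_space chart set \<Rightarrow> 'a vfield \<Rightarrow> real \<Rightarrow> 'a set \<Rightarrow> (real \<Rightarrow> 'a \<Rightarrow> 'a) \<Rightarrow> bool" where
  "local_flow A V \<epsilon> W \<Phi> \<longleftrightarrow> \<epsilon> > 0 \<and> open W \<and>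
     continuous_on ({-\<epsilon><..<\<epsilon>} \<times> W) (\<lambda>(t, q). \<Phi> t q) \<and>
     (\<forall>b\<in>A. \<forall>c\<in>A. smooth_on (\<lambda>(t, x). coord c (\<Phi> t (inv_chart b x)))
        {(t, x). t \<in> {-\<epsilon><..<\<epsilon>} \<and> x \<in> coord b ` (W \<inter> dom_chart b) \<and>
                 \<Phi> t (inv_chart b x) \<in> dom_chart c}) \<and>
     (\<forall>q\<in>W. \<Phi> 0 q = q) \<and>
     (\<forall>t\<in>{-\<epsilon><..<\<epsilon>}. \<forall>q\<in>W.
        ((\<lambda>s. coord (pchart A (\<Phi> t q)) (\<Phi> s q)) has_vector_derivative V (\<Phi> t q)) (at t))"

text \<open>
  Since local flows of a smooth vector field exist around every point and are unique, it suffices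
  to have, around every point, one local flow that consists of symmetries.
\<close>

definition infinitesimal_symmetry ::
  "'a::topological_space chart set \<Rightarrow> ('a \<Rightarrow> (real^3) set) \<Rightarrow>
   ('a \<Rightarrow> real^3 \<Rightarrow> real^3 \<Rightarrow> real) \<Rightarrow> 'a vfield \<Rightarrow> bool" where
  "infinitesimal_symmetry A \<Delta> g V \<longleftrightarrow> smooth_vfield A UNIV V \<and>
     (\<forall>p. \<exists>\<epsilon> W \<Phi>. p \<in> W \<and> local_flow A V \<epsilon> W \<Phi> \<and>
        (\<forall>t\<in>{-\<epsilon><..<\<epsilon>}. symmetry A \<Delta> g W (\<Phi> t)))"

end

theory Submission imports Defs begin

text \<open>
  The idea is that a contact form with \<open>d\<eta>\<^sup>3 = \<eta>\<^sup>1 \<and> \<eta>\<^sup>2\<close> is normalised by the metric, so that a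
  symmetry must preserve it exactly, and that the remaining freedom is a rotation of
  \<open>(\<eta>\<^sup>1, \<eta>\<^sup>2)\<close>.  Differentiating at time 0 along the flow of \<open>V\<close>, the conditions that the flow
  preserves \<open>\<Delta>\<close> and the metric say that \<open>L\<^sub>V\<eta>\<^sup>3\<close> vanishes on \<open>\<Delta>\<close> and that the matrix of
  \<open>(L\<^sub>V\<eta>\<^sup>1, L\<^sub>V\<eta>\<^sup>2)\<close> on \<open>(E\<^sub>1, E\<^sub>2)\<close> is skew (\<open>lie_derivative_conditions\<close>).
  By Cartan's formula \<open>L\<^sub>V\<alpha> = i\<^sub>Vd\<alpha> + d(\<alpha>(V))\<close>, with \<open>f = \<eta>\<^sup>3(V)\<close>, the first condition reads
  \<open>E\<^sub>1f = \<eta>\<^sup>2(V)\<close> and \<open>E\<^sub>2f = - \<eta>\<^sup>1(V)\<close>, which is the formula for \<open>V\<close>, and uniqueness of \<open>f\<close> is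
  immediate.  Then \<open>E\<^sub>3f = 0\<close> drops out of the commutator \<open>[E\<^sub>1, E\<^sub>2]f\<close>, because the trace of the
  skew matrix is zero and \<open>d d\<eta>\<^sup>3 = 0\<close> forces \<open>C\<^sup>1\<^sub>3\<^sub>1 = C\<^sup>2\<^sub>2\<^sub>3\<close>.

  The commutators of \<open>E\<^sub>3\<close> with \<open>E\<^sub>1\<close> and \<open>E\<^sub>2\<close>, applied to \<open>f\<close>, complete this to
  \<open>[V, E\<^sub>1] = \<rho> E\<^sub>2\<close>, \<open>[V, E\<^sub>2] = - \<rho> E\<^sub>1\<close>, \<open>[V, E\<^sub>3] = 0\<close> for some function \<open>\<rho>\<close>.  The Jacobi identity
  for \<open>V\<close> and two frame fields then gives the derivatives of the structure functions along \<open>V\<close>: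
  the pair \<open>((C\<^sup>1\<^sub>2\<^sub>3 - C\<^sup>2\<^sub>3\<^sub>1) / 2, C\<^sup>1\<^sub>3\<^sub>1)\<close> is rotated with speed \<open>2\<rho>\<close>, so its squared length
  \<open>M\<close> is invariant, and the derivatives of \<open>\<rho>\<close> that appear in \<open>V(K)\<close> cancel.  The two
  equations \<open>V(M) = 0\<close> and \<open>V(K) = 0\<close> are linear in \<open>E\<^sub>1f\<close>, \<open>E\<^sub>2f\<close> and \<open>f\<close>; Cramer's rule solves
  them for the logarithmic derivatives of \<open>f\<close>, which is nonzero where \<open>V\<close> is transversal to \<open>\<Delta>\<close>.

  The vector fields are treated as derivations of functions throughout.  By the chain rule, the
  action of a field on a function can be computed in any chart, so that identities between
  iterated derivatives can be established at each point in the chart chosen there.  The passage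
  from the structure equations to commutators is \<open>frame_commutator\<close>, the
  differentiation along the flow is \<open>has_real_derivative_form_flow\<close>, and everything after that is
  algebra in a commutative ring with derivations (locales \<open>contact_frame\<close> and
  \<open>contact_symmetry\<close>).
\<close>

section \<open>Smooth functions on open sets of normed spaces\<close>

lemma has_derivative_frechet:
  "f differentiable (at x) \<Longrightarrow> (f has_derivative frechet_derivative f (at x)) (at x)"
  by (simp add: frechet_derivative_works)

lemma frechet_derivative_eqI:
  "(f has_derivative f') (at x) \<Longrightarrow> frechet_derivative f (at x) = f'"
  using frechet_derivative_at by metis

lemma frechet_derivative_cong_open:
  assumes "open S" "x \<in> S" "\<And>y. y \<in> S \<Longrightarrow> f y = g y"
  shows "frechet_derivative f (at x) = frechet_derivative g (at x)"
proof -
  have "(f has_derivative f') (at x) \<longleftrightarrow> (g has_derivative f') (at x)" for f'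
    using assms has_derivative_transform_within_open[of f f' x UNIV S g]
      has_derivative_transform_within_open[of g f' x UNIV S f] by auto
  then show ?thesis
    by (simp add: frechet_derivative_def)
qed

lemma differentiable_cong_open:
  assumes "open S" "x \<in> S" "\<And>y. y \<in> S \<Longrightarrow> f y = g y"
  shows "f differentiable (at x) \<longleftrightarrow> g differentiable (at x)"
  using assms has_derivative_transform_within_open[of f _ x UNIV S g]
      has_derivative_transform_within_open[of g _ x UNIV S f]
  unfolding differentiable_def by metis

lemma Ck_on_cong:
  assumes "open S" "\<And>y. y \<in> S \<Longrightarrow> f y = g y"
  shows "Ck_on k f S \<longleftrightarrow> Ck_on k g S"
  using assms(2)
proof (induction k arbitrary: f g)
  case 0
  then show ?case using continuous_on_cong by auto
next
  case (Suc k)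
  have d: "f differentiable (at x) \<longleftrightarrow> g differentiable (at x)" if "x \<in> S" for x
    using differentiable_cong_open[OF assms(1) that] Suc.prems by blast
  have "frechet_derivative f (at x) v = frechet_derivative g (at x) v" if "x \<in> S" for x v
    using frechet_derivative_cong_open[OF assms(1) that, of f g] Suc.prems by simp
  then have "Ck_on k (\<lambda>x. frechet_derivative f (at x) v) S
      \<longleftrightarrow> Ck_on k (\<lambda>x. frechet_derivative g (at x) v) S" for v
    by (rule Suc.IH)
  with d show ?case by auto
qed

lemma Ck_on_subset: "Ck_on k f S \<Longrightarrow> T \<subseteq> S \<Longrightarrow> Ck_on k f T"
  by (induction k arbitrary: f) (auto intro: continuous_on_subset)

lemma Ck_on_SucD: "Ck_on (Suc k) f S \<Longrightarrow> Ck_on k f S"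
proof (induction k arbitrary: f)
  case 0
  then show ?case
    by (auto intro!: continuous_at_imp_continuous_on differentiable_imp_continuous_within)
qed auto

lemma Ck_on_const: "Ck_on k (\<lambda>x. c) S"
  by (induction k arbitrary: c) auto

lemma Ck_on_add:
  assumes "open S"
  shows "Ck_on k f S \<Longrightarrow> Ck_on k g S \<Longrightarrow> Ck_on k (\<lambda>x. f x + g x) S"
proof (induction k arbitrary: f g)
  case 0
  then show ?case by (auto intro: continuous_intros)
next
  case (Suc k)
  have "frechet_derivative (\<lambda>x. f x + g x) (at x) v
      = frechet_derivative f (at x) v + frechet_derivative g (at x) v" if "x \<in> S" for x v
    using Suc.prems that
    by (subst frechet_derivative_eqI[OF has_derivative_add[OF has_derivative_frechet has_derivative_frechet]])
       auto
  then have "Ck_on k (\<lambda>x. frechet_derivative (\<lambda>x. f x + g x) (at x) v) S" for v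
    using Ck_on_cong[OF assms, of "\<lambda>x. frechet_derivative (\<lambda>x. f x + g x) (at x) v"] Suc by auto
  then show ?case using Suc.prems by auto
qed

lemma Ck_on_mult:
  fixes f g :: "'v::real_normed_vector \<Rightarrow> real"
  assumes "open S"
  shows "Ck_on k f S \<Longrightarrow> Ck_on k g S \<Longrightarrow> Ck_on k (\<lambda>x. f x * g x) S"
proof (induction k arbitrary: f g)
  case 0
  then show ?case by (auto intro: continuous_intros)
next
  case (Suc k)
  have "frechet_derivative (\<lambda>x. f x * g x) (at x) v
      = f x * frechet_derivative g (at x) v + frechet_derivative f (at x) v * g x" if "x \<in> S" for x v
    using Suc.prems that
    by (subst frechet_derivative_eqI[OF has_derivative_mult[OF has_derivative_frechet has_derivative_frechet]])
       auto
  moreover have "Ck_on k (\<lambda>x. f x * frechet_derivative g (at x) v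
      + frechet_derivative f (at x) v * g x) S" for v
    using Suc.prems Ck_on_SucD[of k f S] Ck_on_SucD[of k g S]
    by (intro Ck_on_add[OF assms] Suc.IH) auto
  ultimately have "Ck_on k (\<lambda>x. frechet_derivative (\<lambda>x. f x * g x) (at x) v) S" for v
    using Ck_on_cong[OF assms, of "\<lambda>x. frechet_derivative (\<lambda>x. f x * g x) (at x) v"] by auto
  then show ?case using Suc.prems by auto
qed

lemma Ck_on_bounded_linear:
  assumes "bounded_linear L" "open S"
  shows "Ck_on k f S \<Longrightarrow> Ck_on k (\<lambda>x. L (f x)) S"
proof (induction k arbitrary: f)
  case 0
  then show ?case using assms by (auto intro: linear_continuous_on bounded_linear.continuous_on)
next
  case (Suc k)
  note D = bounded_linear.has_derivative[OF assms(1) has_derivative_frechet]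
  have "frechet_derivative (\<lambda>x. L (f x)) (at x) v = L (frechet_derivative f (at x) v)"
    if "x \<in> S" for x v
    using Suc.prems that by (subst frechet_derivative_eqI[OF D]) auto
  then have "Ck_on k (\<lambda>x. frechet_derivative (\<lambda>x. L (f x)) (at x) v) S" for v
    using Ck_on_cong[OF assms(2), of "\<lambda>x. frechet_derivative (\<lambda>x. L (f x)) (at x) v"] Suc by auto
  moreover have "(\<lambda>x. L (f x)) differentiable (at x)" if "x \<in> S" for x
    using D[of f x] Suc.prems that by (auto simp: differentiable_def)
  ultimately show ?case by auto
qed

lemma smooth_on_cong:
  "open S \<Longrightarrow> (\<And>y. y \<in> S \<Longrightarrow> f y = g y) \<Longrightarrow> smooth_on f S \<longleftrightarrow> smooth_on g S"
  unfolding smooth_on_def using Ck_on_cong by metis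

lemma smooth_on_eqI:
  "smooth_on g S \<Longrightarrow> open S \<Longrightarrow> (\<And>y. y \<in> S \<Longrightarrow> f y = g y) \<Longrightarrow> smooth_on f S"
  using smooth_on_cong[of S f g] by blast

lemma smooth_on_subset: "smooth_on f S \<Longrightarrow> T \<subseteq> S \<Longrightarrow> smooth_on f T"
  unfolding smooth_on_def using Ck_on_subset by blast

lemma smooth_on_const: "smooth_on (\<lambda>x. c) S"
  unfolding smooth_on_def using Ck_on_const by blast

lemma smooth_on_add:
  "open S \<Longrightarrow> smooth_on f S \<Longrightarrow> smooth_on g S \<Longrightarrow> smooth_on (\<lambda>x. f x + g x) S"
  unfolding smooth_on_def using Ck_on_add by blast

lemma smooth_on_mult:
  fixes f g :: "'v::real_normed_vector \<Rightarrow> real"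
  shows "open S \<Longrightarrow> smooth_on f S \<Longrightarrow> smooth_on g S \<Longrightarrow> smooth_on (\<lambda>x. f x * g x) S"
  unfolding smooth_on_def using Ck_on_mult by blast

lemma smooth_on_bounded_linear:
  "bounded_linear L \<Longrightarrow> open S \<Longrightarrow> smooth_on f S \<Longrightarrow> smooth_on (\<lambda>x. L (f x)) S"
  unfolding smooth_on_def using Ck_on_bounded_linear by blast

lemma smooth_on_sum:
  assumes "open S" "finite I" "\<And>i. i \<in> I \<Longrightarrow> smooth_on (f i) S"
  shows "smooth_on (\<lambda>x. \<Sum>i\<in>I. f i x) S"
  using assms(2,3) by (induction I) (auto intro: smooth_on_const smooth_on_add[OF assms(1)])

lemma smooth_on_nth:
  fixes f :: "'v::real_normed_vector \<Rightarrow> real^'n"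
  shows "open S \<Longrightarrow> smooth_on f S \<Longrightarrow> smooth_on (\<lambda>x. f x $ i) S"
  using smooth_on_bounded_linear[OF bounded_linear_vec_nth] .

lemma smooth_on_differentiable: "smooth_on f S \<Longrightarrow> x \<in> S \<Longrightarrow> f differentiable (at x)"
  unfolding smooth_on_def by (metis Ck_on.simps(2))

lemma smooth_on_continuous: "smooth_on f S \<Longrightarrow> continuous_on S f"
  unfolding smooth_on_def by (metis Ck_on.simps(1))

lemma smooth_on_frechet_derivative:
  "smooth_on f S \<Longrightarrow> smooth_on (\<lambda>x. frechet_derivative f (at x) v) S"
  unfolding smooth_on_def by (metis Ck_on.simps(2))

lemma has_derivative_smooth_on:
  "smooth_on f S \<Longrightarrow> x \<in> S \<Longrightarrow> (f has_derivative frechet_derivative f (at x)) (at x)"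
  by (intro has_derivative_frechet smooth_on_differentiable)

text \<open>The mean value theorem is applied first in direction \<open>u\<close>, to the increment in direction \<open>v\<close>, and
  then to the derivative along \<open>u\<close> in direction \<open>v\<close>.\<close>

lemma second_difference_mean_value:
  fixes f :: "'v::real_normed_vector \<Rightarrow> real"
  assumes f: "smooth_on f S" and S: "ball x r \<subseteq> S" and h: "0 < h" "h * (norm u + norm v) < r"
  shows "\<exists>y\<in>ball x r. f (x + h *\<^sub>R u + h *\<^sub>R v) - f (x + h *\<^sub>R u) - f (x + h *\<^sub>R v) + f x
           = h * h * frechet_derivative (\<lambda>y. frechet_derivative f (at y) u) (at y) v"
proof -
  have inS: "x + s *\<^sub>R u + t *\<^sub>R v \<in> ball x r" if "0 \<le> s" "s \<le> h" "0 \<le> t" "t \<le> h" for s t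
  proof -
    have "norm (s *\<^sub>R u + t *\<^sub>R v) \<le> s * norm u + t * norm v"
      using that norm_triangle_ineq[of "s *\<^sub>R u" "t *\<^sub>R v"] by simp
    also have "\<dots> \<le> h * norm u + h * norm v"
      using that by (intro add_mono mult_right_mono) auto
    also have "\<dots> < r" using h by (simp add: algebra_simps)
    finally show ?thesis
      using dist_norm[of "x + (s *\<^sub>R u + t *\<^sub>R v)" x] by (simp add: dist_commute add.assoc)
  qed
  have dir: "((\<lambda>t. k (z + t *\<^sub>R w)) has_real_derivative frechet_derivative k (at (z + t *\<^sub>R w)) w) (at t)"
    if "smooth_on k S" "z + t *\<^sub>R w \<in> S" for k :: "'v \<Rightarrow> real" and z w t
  proof -
    have "((\<lambda>t. z + t *\<^sub>R w) has_derivative (\<lambda>t. t *\<^sub>R w)) (at t)"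
      by (auto intro!: derivative_eq_intros)
    from has_derivative_compose[OF this has_derivative_smooth_on[OF that]]
    have "((\<lambda>t. k (z + t *\<^sub>R w)) has_derivative
        (\<lambda>s. frechet_derivative k (at (z + t *\<^sub>R w)) (s *\<^sub>R w))) (at t)" .
    moreover have "frechet_derivative k (at (z + t *\<^sub>R w)) (s *\<^sub>R w)
        = frechet_derivative k (at (z + t *\<^sub>R w)) w * s" for s
      using linear_frechet_derivative[OF smooth_on_differentiable[OF that]]
      by (simp add: linear_scale)
    ultimately show ?thesis by (simp add: has_field_derivative_def mult_commute_abs)
  qed
  define \<phi> where "\<phi> s = f (x + s *\<^sub>R u + h *\<^sub>R v) - f (x + s *\<^sub>R u)" for s
  have "\<exists>s. 0 < s \<and> s < h \<and> \<phi> h - \<phi> 0 = (h - 0) *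
      (frechet_derivative f (at (x + s *\<^sub>R u + h *\<^sub>R v)) u - frechet_derivative f (at (x + s *\<^sub>R u)) u)"
  proof (rule MVT2[OF h(1)])
    fix s assume s: "0 \<le> s" "s \<le> h"
    show "(\<phi> has_real_derivative frechet_derivative f (at (x + s *\<^sub>R u + h *\<^sub>R v)) u
        - frechet_derivative f (at (x + s *\<^sub>R u)) u) (at s)"
      unfolding \<phi>_def
    proof (rule DERIV_diff)
      have e: "x + t *\<^sub>R u + h *\<^sub>R v = (x + h *\<^sub>R v) + t *\<^sub>R u" for t by simp
      show "((\<lambda>s. f (x + s *\<^sub>R u + h *\<^sub>R v)) has_real_derivative
          frechet_derivative f (at (x + s *\<^sub>R u + h *\<^sub>R v)) u) (at s)"
        unfolding e using inS[of s h] s h S by (intro dir f) (auto simp: e)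
      show "((\<lambda>s. f (x + s *\<^sub>R u)) has_real_derivative
          frechet_derivative f (at (x + s *\<^sub>R u)) u) (at s)"
        using inS[of s 0] s h S by (intro dir f) auto
    qed
  qed
  then obtain s where s: "0 < s" "s < h" "\<phi> h - \<phi> 0 = h *
      (frechet_derivative f (at (x + s *\<^sub>R u + h *\<^sub>R v)) u - frechet_derivative f (at (x + s *\<^sub>R u)) u)"
    by auto
  have "\<exists>t. 0 < t \<and> t < h \<and> frechet_derivative f (at (x + s *\<^sub>R u + h *\<^sub>R v)) u
      - frechet_derivative f (at (x + s *\<^sub>R u + 0 *\<^sub>R v)) u = (h - 0) *
      frechet_derivative (\<lambda>y. frechet_derivative f (at y) u) (at (x + s *\<^sub>R u + t *\<^sub>R v)) v"
    using inS s S by (intro MVT2[OF h(1)] dir smooth_on_frechet_derivative f) auto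
  then obtain t where t: "0 < t" "t < h" "frechet_derivative f (at (x + s *\<^sub>R u + h *\<^sub>R v)) u
      - frechet_derivative f (at (x + s *\<^sub>R u)) u
      = h * frechet_derivative (\<lambda>y. frechet_derivative f (at y) u) (at (x + s *\<^sub>R u + t *\<^sub>R v)) v"
    by auto
  have "\<phi> h - \<phi> 0 = h * h *
      frechet_derivative (\<lambda>y. frechet_derivative f (at y) u) (at (x + s *\<^sub>R u + t *\<^sub>R v)) v"
    using s(3) t(3) by simp
  moreover have "x + s *\<^sub>R u + t *\<^sub>R v \<in> ball x r"
    using inS[of s t] s t by auto
  ultimately show ?thesis by (intro bexI) (auto simp: \<phi>_def)
qed

text \<open>Both mixed second derivatives are limits of the same quotient of second differences, which is
  symmetric in the two directions.\<close>

lemma second_derivative_symmetric_real: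
  fixes f :: "'v::real_normed_vector \<Rightarrow> real"
  assumes f: "smooth_on f S" and S: "open S" "x \<in> S"
  shows "frechet_derivative (\<lambda>y. frechet_derivative f (at y) u) (at x) v
       = frechet_derivative (\<lambda>y. frechet_derivative f (at y) v) (at x) u"
proof -
  define P where "P y = frechet_derivative (\<lambda>y. frechet_derivative f (at y) u) (at y) v" for y
  define Q where "Q y = frechet_derivative (\<lambda>y. frechet_derivative f (at y) v) (at y) u" for y
  note D2 = smooth_on_frechet_derivative[OF smooth_on_frechet_derivative[OF f]]
  have "continuous_on S P" unfolding P_def[abs_def]
    by (rule smooth_on_continuous[OF D2])
  then have "isCont P x"
    using continuous_on_eq_continuous_at[OF S(1), of P] S(2) by simp
  moreover have "continuous_on S Q" unfolding Q_def[abs_def]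
    by (rule smooth_on_continuous[OF D2])
  then have "isCont Q x"
    using continuous_on_eq_continuous_at[OF S(1), of Q] S(2) by simp
  ultimately have cont: "isCont P x" "isCont Q x" .
  have "\<bar>P x - Q x\<bar> < 2 * e" if e: "e > 0" for e
  proof -
    obtain a where a: "a > 0" "\<And>y. dist y x < a \<Longrightarrow> dist (P y) (P x) < e"
      using cont(1)[unfolded continuous_at_eps_delta, rule_format, OF e] by auto
    obtain b where b: "b > 0" "\<And>y. dist y x < b \<Longrightarrow> dist (Q y) (Q x) < e"
      using cont(2)[unfolded continuous_at_eps_delta, rule_format, OF e] by auto
    obtain c where c: "c > 0" "ball x c \<subseteq> S"
      using openE[OF S] by auto
    define r where "r = min a (min b c)"
    have r: "r > 0" "ball x r \<subseteq> S" using a b c by (auto simp: r_def)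
    define h where "h = r / (2 * (norm u + norm v + 1))"
    have n: "norm u + norm v + 1 > 0" by (simp add: add_nonneg_pos)
    have "h > 0" using r(1) n by (simp add: h_def)
    moreover have "h * (norm u + norm v) < r"
    proof -
      have "h * (norm u + norm v) \<le> h * (norm u + norm v + 1)"
        using \<open>h > 0\<close> by simp
      also have "\<dots> = r / 2" using n by (simp add: h_def field_simps)
      finally show ?thesis using r(1) by simp
    qed
    ultimately have h: "0 < h" "h * (norm u + norm v) < r" "h * (norm v + norm u) < r"
      by (simp_all add: add.commute)
    obtain y where y: "y \<in> ball x r"
      "f (x + h *\<^sub>R u + h *\<^sub>R v) - f (x + h *\<^sub>R u) - f (x + h *\<^sub>R v) + f x = h * h * P y"
      using second_difference_mean_value[OF f r(2) h(1,2)] unfolding P_def by blast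
    obtain z where z: "z \<in> ball x r"
      "f (x + h *\<^sub>R v + h *\<^sub>R u) - f (x + h *\<^sub>R v) - f (x + h *\<^sub>R u) + f x = h * h * Q z"
      using second_difference_mean_value[OF f r(2) h(1,3)] unfolding Q_def by blast
    have "x + h *\<^sub>R v + h *\<^sub>R u = x + h *\<^sub>R u + h *\<^sub>R v" by simp
    from z(2)[unfolded this] y(2) have "h * h * P y = h * h * Q z" by linarith
    then have "P y = Q z" using h(1) by simp
    moreover have "dist (P y) (P x) < e" "dist (Q z) (Q x) < e"
      using y(1) z(1) a(2)[of y] b(2)[of z] by (auto simp: r_def dist_commute)
    ultimately show ?thesis by (simp add: dist_real_def)
  qed
  from this[of "\<bar>P x - Q x\<bar> / 2"] have "P x = Q x" by fastforce
  then show ?thesis by (simp add: P_def Q_def)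
qed

lemma second_derivative_symmetric:
  fixes f :: "'v::real_normed_vector \<Rightarrow> real^'n"
  assumes f: "smooth_on f S" and S: "open S" "x \<in> S"
  shows "frechet_derivative (\<lambda>y. frechet_derivative f (at y) u) (at x) v
       = frechet_derivative (\<lambda>y. frechet_derivative f (at y) v) (at x) u"
proof -
  have nth: "frechet_derivative (\<lambda>y. k y $ i) (at y) w = frechet_derivative k (at y) w $ i"
    if "smooth_on k S" "y \<in> S" for k :: "'v \<Rightarrow> real^'n" and y w i
    using fun_cong[OF frechet_derivative_eqI[OF
        bounded_linear.has_derivative[OF bounded_linear_vec_nth has_derivative_smooth_on[OF that]]]] .
  have "frechet_derivative (\<lambda>y. frechet_derivative f (at y) u) (at x) v $ i
      = frechet_derivative (\<lambda>y. frechet_derivative (\<lambda>y. f y $ i) (at y) u) (at x) v" for i u v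
    using nth[OF smooth_on_frechet_derivative[OF f] S(2)]
      frechet_derivative_cong_open[OF S, of "\<lambda>y. frechet_derivative (\<lambda>y. f y $ i) (at y) u"
        "\<lambda>y. frechet_derivative f (at y) u $ i"] nth[OF f]
    by auto
  then show ?thesis
    using second_derivative_symmetric_real[OF smooth_on_nth[OF S(1) f] S]
    by (simp add: vec_eq_iff)
qed

lemma linear_expand_axis:
  fixes L :: "real^3 \<Rightarrow> 'w::real_vector"
  assumes "linear L"
  shows "L w = (\<Sum>i\<in>UNIV. w $ i *\<^sub>R L (axis i 1))"
proof -
  have "L w = L (\<Sum>i\<in>UNIV. w $ i *\<^sub>R axis i 1)"
    using basis_expansion[of w] by (simp add: scalar_mult_eq_scaleR)
  then show ?thesis by (simp add: linear_sum[OF assms] linear_scale[OF assms])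
qed

section \<open>Calculus on a 3-manifold\<close>

locale manifold3 =
  fixes A :: "'a::{t2_space, second_countable_topology} chart set"
  assumes manifold: "oriented_manifold3 A"
begin

lemma chart: "c \<in> A \<Longrightarrow> is_chart c"
  using manifold by (simp add: oriented_manifold3_def)

lemma open_dom: "c \<in> A \<Longrightarrow> open (dom_chart c)"
  using chart by (simp add: is_chart_def)

lemma inv_chart_coord: "c \<in> A \<Longrightarrow> q \<in> dom_chart c \<Longrightarrow> inv_chart c (coord c q) = q"
  using chart[of c] by (auto simp: is_chart_def homeomorphism_def)

lemma coord_inv_chart: "c \<in> A \<Longrightarrow> x \<in> coord c ` dom_chart c \<Longrightarrow> coord c (inv_chart c x) = x"
  using chart[of c] by (auto simp: is_chart_def homeomorphism_def)

lemma pchart: "pchart A q \<in> A" "q \<in> dom_chart (pchart A q)"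
proof -
  have "\<exists>c. c \<in> A \<and> q \<in> dom_chart c"
    using manifold unfolding oriented_manifold3_def by blast
  from someI_ex[OF this] show "pchart A q \<in> A" "q \<in> dom_chart (pchart A q)"
    unfolding pchart_def by auto
qed

lemma continuous_inv_chart: "c \<in> A \<Longrightarrow> continuous_on (coord c ` dom_chart c) (inv_chart c)"
  using chart[of c] by (auto simp: is_chart_def homeomorphism_def)

lemma open_coord_image:
  assumes "c \<in> A" "open U"
  shows "open (coord c ` (U \<inter> dom_chart c))"
proof -
  have "open (coord c ` dom_chart c \<inter> inv_chart c -` U)"
    using chart[OF assms(1)] assms(2)
    by (intro continuous_open_preimage) (auto simp: is_chart_def homeomorphism_def)
  moreover have "coord c ` dom_chart c \<inter> inv_chart c -` U = coord c ` (U \<inter> dom_chart c)"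
    using inv_chart_coord[OF assms(1)] by auto
  ultimately show ?thesis by simp
qed

lemma transition_has_derivative:
  assumes "b \<in> A" "c \<in> A" "q \<in> dom_chart b" "q \<in> dom_chart c"
  shows "((coord c \<circ> inv_chart b) has_derivative tchange b c q) (at (coord b q))"
proof -
  have "smooth_on (coord c \<circ> inv_chart b) (coord b ` (dom_chart b \<inter> dom_chart c))"
    using manifold assms by (auto simp: oriented_manifold3_def)
  from has_derivative_smooth_on[OF this] show ?thesis
    using assms by (auto simp: tchange_def)
qed

lemma linear_tchange:
  "b \<in> A \<Longrightarrow> c \<in> A \<Longrightarrow> q \<in> dom_chart b \<Longrightarrow> q \<in> dom_chart c \<Longrightarrow> linear (tchange b c q)"
  using has_derivative_linear[OF transition_has_derivative] .

text \<open>Change of charts for maps from the manifold to any normed space: the chain rule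
  through a transition map.\<close>

lemma has_derivative_change_chart:
  fixes h :: "'a \<Rightarrow> 'w::real_normed_vector"
  assumes b: "b \<in> A" "q \<in> dom_chart b" and c: "c \<in> A" "q \<in> dom_chart c"
    and D: "((h \<circ> inv_chart b) has_derivative D) (at (coord b q))"
  shows "((h \<circ> inv_chart c) has_derivative (\<lambda>w. D (tchange c b q w))) (at (coord c q))"
proof -
  have "(coord b \<circ> inv_chart c) (coord c q) = coord b q"
    using inv_chart_coord c by simp
  with D have "((h \<circ> inv_chart b) has_derivative D) (at ((coord b \<circ> inv_chart c) (coord c q)))"
    by simp
  from has_derivative_compose[OF transition_has_derivative[OF c(1) b(1) c(2) b(2)] this]
  have "((\<lambda>x. (h \<circ> inv_chart b) ((coord b \<circ> inv_chart c) x)) has_derivative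
      (\<lambda>w. D (tchange c b q w))) (at (coord c q))" .
  then show ?thesis
  proof (rule has_derivative_transform_within_open)
    show "open (coord c ` (dom_chart b \<inter> dom_chart c))"
      using open_coord_image[OF c(1) open_dom[OF b(1)]] .
    show "coord c q \<in> coord c ` (dom_chart b \<inter> dom_chart c)"
      using b c by blast
    show "(h \<circ> inv_chart b) ((coord b \<circ> inv_chart c) x) = (h \<circ> inv_chart c) x"
      if "x \<in> coord c ` (dom_chart b \<inter> dom_chart c)" for x
      using that by (auto simp: inv_chart_coord[OF b(1)] inv_chart_coord[OF c(1)])
  qed
qed

lemma tchange_self: "c \<in> A \<Longrightarrow> q \<in> dom_chart c \<Longrightarrow> tchange c c q = (\<lambda>w. w)"
proof -
  assume c: "c \<in> A" "q \<in> dom_chart c"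
  have "((\<lambda>x. x) has_derivative (\<lambda>w. w)) (at (coord c q))" by (rule has_derivative_ident)
  then have "((coord c \<circ> inv_chart c) has_derivative (\<lambda>w. w)) (at (coord c q))"
  proof (rule has_derivative_transform_within_open)
    show "open (coord c ` (dom_chart c \<inter> dom_chart c))"
      using open_coord_image[OF c(1) open_dom[OF c(1)]] .
  qed (use c coord_inv_chart in auto)
  then show ?thesis
    by (simp add: tchange_def frechet_derivative_eqI)
qed

lemma tchange_trans:
  assumes "b \<in> A" "q \<in> dom_chart b" "c \<in> A" "q \<in> dom_chart c" "d \<in> A" "q \<in> dom_chart d"
  shows "tchange c d q (tchange b c q w) = tchange b d q w"
proof -
  have "((coord d \<circ> inv_chart b) has_derivative (\<lambda>w. tchange c d q (tchange b c q w))) (at (coord b q))"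
    by (rule has_derivative_change_chart[OF assms(3,4,1,2)
        transition_has_derivative[OF assms(3,5,4,6)]])
  from frechet_derivative_eqI[OF this] show ?thesis
    unfolding tchange_def[of b d] by metis
qed

lemma tchange_inverse:
  assumes "b \<in> A" "q \<in> dom_chart b" "c \<in> A" "q \<in> dom_chart c"
  shows "tchange c b q (tchange b c q w) = w"
  using tchange_trans[OF assms assms(1,2)] tchange_self assms by simp

lemma vderiv_in_chart:
  assumes c: "c \<in> A" "q \<in> dom_chart c"
    and D: "((h \<circ> inv_chart c) has_derivative D) (at (coord c q))"
  shows "vderiv A X h q = D (tchange (pchart A q) c q (X q))"
  using frechet_derivative_eqI[OF has_derivative_change_chart[OF c pchart D]]
  by (simp add: vderiv_def Let_def)

lemma smooth_fun_has_derivative: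
  assumes "smooth_fun A U h" "q \<in> U" "c \<in> A" "q \<in> dom_chart c"
  shows "((h \<circ> inv_chart c) has_derivative frechet_derivative (h \<circ> inv_chart c) (at (coord c q)))
    (at (coord c q))"
  using assms has_derivative_smooth_on[of "h \<circ> inv_chart c" "coord c ` (U \<inter> dom_chart c)" "coord c q"]
  by (auto simp: smooth_fun_def)

lemma smooth_fun_pchart_has_derivative:
  assumes "smooth_fun A U h" "q \<in> U"
  shows "((\<lambda>x. h (inv_chart (pchart A q) x)) has_derivative (\<lambda>w. vderiv A (\<lambda>_. w) h q))
    (at (coord (pchart A q) q))"
  using smooth_fun_has_derivative[OF assms pchart] by (simp add: vderiv_def o_def Let_def)

lemma vderiv_const_field: "vderiv A (\<lambda>_. X q) h q = vderiv A X h q"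
  by (simp add: vderiv_def)

lemma vderiv_eqI:
  assumes "((\<lambda>x. h (inv_chart (pchart A q) x)) has_derivative D) (at (coord (pchart A q) q))"
  shows "vderiv A X h q = D (X q)"
  using frechet_derivative_eqI[OF assms] by (simp add: vderiv_def o_def Let_def)

lemma smooth_fun_cong:
  assumes "open U" "smooth_fun A U f" "\<And>q. q \<in> U \<Longrightarrow> f q = h q"
  shows "smooth_fun A U h"
  unfolding smooth_fun_def
proof
  fix c assume c: "c \<in> A"
  show "smooth_on (h \<circ> inv_chart c) (coord c ` (U \<inter> dom_chart c))"
  proof (rule smooth_on_eqI)
    show "smooth_on (f \<circ> inv_chart c) (coord c ` (U \<inter> dom_chart c))"
      using assms(2) c by (simp add: smooth_fun_def)
  qed (use assms(3) inv_chart_coord[OF c] open_coord_image[OF c assms(1)] in auto)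
qed

lemma smooth_fun_subset: "smooth_fun A U f \<Longrightarrow> W \<subseteq> U \<Longrightarrow> smooth_fun A W f"
  unfolding smooth_fun_def by (blast intro: smooth_on_subset)

lemma smooth_vfield_subset: "smooth_vfield A U X \<Longrightarrow> W \<subseteq> U \<Longrightarrow> smooth_vfield A W X"
  unfolding smooth_vfield_def by (blast intro: smooth_on_subset)

lemma smooth_fun_const: "smooth_fun A U (\<lambda>q. k)"
  by (simp add: smooth_fun_def o_def smooth_on_const)

lemma smooth_fun_add:
  "open U \<Longrightarrow> smooth_fun A U f \<Longrightarrow> smooth_fun A U h \<Longrightarrow> smooth_fun A U (\<lambda>q. f q + h q)"
  unfolding smooth_fun_def o_def using smooth_on_add[OF open_coord_image] by blast

lemma smooth_fun_mult:
  "open U \<Longrightarrow> smooth_fun A U f \<Longrightarrow> smooth_fun A U h \<Longrightarrow> smooth_fun A U (\<lambda>q. f q * h q)"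
  unfolding smooth_fun_def o_def using smooth_on_mult[OF open_coord_image] by blast

lemma vderiv_cong:
  assumes "open U" "q \<in> U" "\<And>q. q \<in> U \<Longrightarrow> f q = h q"
  shows "vderiv A X f q = vderiv A X h q"
proof -
  let ?c = "pchart A q"
  have "frechet_derivative (f \<circ> inv_chart ?c) (at (coord ?c q))
      = frechet_derivative (h \<circ> inv_chart ?c) (at (coord ?c q))"
  proof (rule frechet_derivative_cong_open)
    show "open (coord ?c ` (U \<inter> dom_chart ?c))"
      using open_coord_image[OF pchart(1) assms(1)] .
  qed (use assms pchart inv_chart_coord[OF pchart(1)] in auto)
  then show ?thesis by (simp add: vderiv_def Let_def)
qed

lemma vderiv_const: "vderiv A X (\<lambda>q. k) q = 0"
  by (simp add: vderiv_def Let_def o_def)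

lemma vderiv_add:
  assumes "smooth_fun A U f" "smooth_fun A U h" "q \<in> U"
  shows "vderiv A X (\<lambda>q. f q + h q) q = vderiv A X f q + vderiv A X h q"
  using vderiv_eqI[OF has_derivative_add[OF smooth_fun_pchart_has_derivative[OF assms(1,3)]
      smooth_fun_pchart_has_derivative[OF assms(2,3)]]]
  by (simp add: vderiv_const_field)

lemma vderiv_mult:
  assumes "smooth_fun A U f" "smooth_fun A U h" "q \<in> U"
  shows "vderiv A X (\<lambda>q. f q * h q) q = f q * vderiv A X h q + vderiv A X f q * h q"
  using vderiv_eqI[OF has_derivative_mult[OF smooth_fun_pchart_has_derivative[OF assms(1,3)]
      smooth_fun_pchart_has_derivative[OF assms(2,3)]]]
  by (simp add: vderiv_const_field inv_chart_coord pchart)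

lemma linear_vderiv:
  assumes "smooth_fun A U h" "q \<in> U"
  shows "linear (\<lambda>w. vderiv A (\<lambda>_. w) h q)"
  using has_derivative_linear[OF smooth_fun_pchart_has_derivative[OF assms]] .

text \<open>Smoothness of \<open>X(h)\<close> is read off from this formula: the derivative of a smooth function in a
  fixed direction is smooth, and the representative of \<open>X\<close> enters through its components.\<close>

lemma vderiv_rep:
  assumes h: "smooth_fun A U h" and c: "c \<in> A" and x: "x \<in> coord c ` (U \<inter> dom_chart c)"
  shows "vderiv A X h (inv_chart c x) = frechet_derivative (h \<circ> inv_chart c) (at x) (vfield_rep A c X x)"
proof -
  obtain q where q: "q \<in> U" "q \<in> dom_chart c" "x = coord c q" using x by auto
  show ?thesis
    using vderiv_in_chart[OF c q(2) smooth_fun_has_derivative[OF h q(1) c q(2)]]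
    by (simp add: q(3) inv_chart_coord[OF c q(2)] vfield_rep_def Let_def)
qed

lemma smooth_fun_vderiv:
  assumes U: "open U" and h: "smooth_fun A U h" and X: "smooth_vfield A U X"
  shows "smooth_fun A U (vderiv A X h)"
  unfolding smooth_fun_def
proof
  fix c assume c: "c \<in> A"
  let ?N = "coord c ` (U \<inter> dom_chart c)" and ?h = "h \<circ> inv_chart c"
  note oN = open_coord_image[OF c U]
  have hc: "smooth_on ?h ?N" using h c by (simp add: smooth_fun_def)
  have Xc: "smooth_on (vfield_rep A c X) ?N" using X c by (simp add: smooth_vfield_def)
  have "smooth_on (\<lambda>x. \<Sum>i\<in>UNIV. vfield_rep A c X x $ i * frechet_derivative ?h (at x) (axis i 1)) ?N"
    by (intro smooth_on_sum smooth_on_mult oN smooth_on_nth Xc smooth_on_frechet_derivative[OF hc]) auto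
  moreover have "(vderiv A X h \<circ> inv_chart c) x
      = (\<Sum>i\<in>UNIV. vfield_rep A c X x $ i * frechet_derivative ?h (at x) (axis i 1))" if x: "x \<in> ?N" for x
    using vderiv_rep[OF h c x, of X]
      linear_expand_axis[OF linear_frechet_derivative[OF smooth_on_differentiable[OF hc x]],
        of "vfield_rep A c X x"]
    by simp
  ultimately show "smooth_on (vderiv A X h \<circ> inv_chart c) ?N"
    by (rule smooth_on_eqI[OF _ oN])
qed

lemma form1_rep_linear:
  assumes \<alpha>: "smooth_form1 A U \<alpha>" and c: "c \<in> A" and x: "x \<in> coord c ` (U \<inter> dom_chart c)"
  shows "linear (form1_rep A c \<alpha> x)"
proof -
  obtain q where q: "q \<in> U" "q \<in> dom_chart c" "x = coord c q" using x by auto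
  have "linear (\<alpha> q \<circ> tchange c (pchart A q) q)"
    using \<alpha> q c pchart by (intro linear_compose linear_tchange) (auto simp: smooth_form1_def)
  moreover have "form1_rep A c \<alpha> x = \<alpha> q \<circ> tchange c (pchart A q) q"
    by (rule ext) (simp add: form1_rep_def Let_def q(3) inv_chart_coord[OF c q(2)])
  ultimately show ?thesis by simp
qed

lemma form1_rep_vfield_rep:
  assumes c: "c \<in> A" and x: "x \<in> coord c ` dom_chart c"
  shows "form1_rep A c \<alpha> x (vfield_rep A c X x) = \<alpha> (inv_chart c x) (X (inv_chart c x))"
proof -
  obtain q where q: "q \<in> dom_chart c" "x = coord c q" using x by auto
  show ?thesis
    by (simp add: form1_rep_def vfield_rep_def Let_def q(2) inv_chart_coord[OF c q(1)]
        tchange_inverse[OF pchart c q(1)])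
qed

lemma smooth_fun_form_vfield:
  assumes U: "open U" and \<alpha>: "smooth_form1 A U \<alpha>" and X: "smooth_vfield A U X"
  shows "smooth_fun A U (\<lambda>q. \<alpha> q (X q))"
  unfolding smooth_fun_def
proof
  fix c assume c: "c \<in> A"
  let ?N = "coord c ` (U \<inter> dom_chart c)"
  note oN = open_coord_image[OF c U]
  have Xc: "smooth_on (vfield_rep A c X) ?N" using X c by (simp add: smooth_vfield_def)
  have \<alpha>c: "smooth_on (\<lambda>x. form1_rep A c \<alpha> x w) ?N" for w using \<alpha> c by (simp add: smooth_form1_def)
  have "smooth_on (\<lambda>x. \<Sum>i\<in>UNIV. vfield_rep A c X x $ i * form1_rep A c \<alpha> x (axis i 1)) ?N"
    by (intro smooth_on_sum smooth_on_mult oN smooth_on_nth Xc \<alpha>c) auto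
  moreover have "((\<lambda>q. \<alpha> q (X q)) \<circ> inv_chart c) x
      = (\<Sum>i\<in>UNIV. vfield_rep A c X x $ i * form1_rep A c \<alpha> x (axis i 1))" if x: "x \<in> ?N" for x
    using form1_rep_vfield_rep[OF c, of x \<alpha> X] x
      linear_expand_axis[OF form1_rep_linear[OF \<alpha> c x], of "vfield_rep A c X x"]
    by auto
  ultimately show "smooth_on ((\<lambda>q. \<alpha> q (X q)) \<circ> inv_chart c) ?N"
    by (rule smooth_on_eqI[OF _ oN])
qed

end

section \<open>Brackets and exterior derivatives\<close>

text \<open>A family of linear forms is given by its three coefficient functions, so differentiating
  \<open>\<theta> (\<gamma> s) (P s)\<close> is the Leibniz rule.  With \<open>\<gamma>\<close> the identity this differentiates the value of a
  form on a vector field and the value \<open>X(h) = dh(X)\<close>; with \<open>\<gamma>\<close> an integral curve it differentiates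
  a form on a vector transported by the flow.\<close>

lemma has_derivative_linear_family:
  fixes \<theta> :: "'v::real_normed_vector \<Rightarrow> real^3 \<Rightarrow> real" and \<gamma> :: "'s::real_normed_vector \<Rightarrow> 'v"
  assumes N: "open N" "\<gamma> s \<in> N" and lin: "\<And>x. x \<in> N \<Longrightarrow> linear (\<theta> x)"
    and diff: "\<And>w. (\<lambda>x. \<theta> x w) differentiable (at (\<gamma> s))"
    and \<gamma>: "(\<gamma> has_derivative \<gamma>') (at s)" and P: "(P has_derivative P') (at s)"
  shows "((\<lambda>s. \<theta> (\<gamma> s) (P s)) has_derivative
    (\<lambda>h. frechet_derivative (\<lambda>x. \<theta> x (P s)) (at (\<gamma> s)) (\<gamma>' h) + \<theta> (\<gamma> s) (P' h))) (at s)"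
proof -
  let ?D = "\<lambda>i. frechet_derivative (\<lambda>x. \<theta> x (axis i 1)) (at (\<gamma> s))"
  have D: "((\<lambda>x. \<theta> x (axis i 1)) has_derivative ?D i) (at (\<gamma> s))" for i
    by (intro has_derivative_frechet diff)
  have expand: "\<theta> x w = (\<Sum>i\<in>UNIV. w $ i * \<theta> x (axis i 1))" if "x \<in> N" for x w
    using linear_expand_axis[OF lin[OF that], of w] by simp
  have "((\<lambda>x. \<Sum>i\<in>UNIV. P s $ i * \<theta> x (axis i 1)) has_derivative
      (\<lambda>k. \<Sum>i\<in>UNIV. P s $ i * ?D i k)) (at (\<gamma> s))"
    by (intro has_derivative_sum has_derivative_mult_right D)
  then have "((\<lambda>x. \<theta> x (P s)) has_derivative (\<lambda>k. \<Sum>i\<in>UNIV. P s $ i * ?D i k)) (at (\<gamma> s))"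
    by (rule has_derivative_transform_within_open[OF _ N]) (rule expand[symmetric])
  then have DP: "frechet_derivative (\<lambda>x. \<theta> x (P s)) (at (\<gamma> s)) k = (\<Sum>i\<in>UNIV. P s $ i * ?D i k)" for k
    by (simp add: frechet_derivative_eqI)
  have "((\<lambda>s. \<Sum>i\<in>UNIV. P s $ i * \<theta> (\<gamma> s) (axis i 1)) has_derivative
      (\<lambda>h. \<Sum>i\<in>UNIV. P s $ i * ?D i (\<gamma>' h) + P' h $ i * \<theta> (\<gamma> s) (axis i 1))) (at s)"
    by (intro has_derivative_sum has_derivative_mult has_derivative_compose[OF \<gamma> D]
        bounded_linear.has_derivative[OF bounded_linear_vec_nth P])
  moreover have "(\<Sum>i\<in>UNIV. P s $ i * ?D i (\<gamma>' h) + P' h $ i * \<theta> (\<gamma> s) (axis i 1))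
      = frechet_derivative (\<lambda>x. \<theta> x (P s)) (at (\<gamma> s)) (\<gamma>' h) + \<theta> (\<gamma> s) (P' h)" for h
    unfolding DP expand[OF N(2), of "P' h"] by (rule sum.distrib)
  ultimately have "((\<lambda>s. \<Sum>i\<in>UNIV. P s $ i * \<theta> (\<gamma> s) (axis i 1)) has_derivative
      (\<lambda>h. frechet_derivative (\<lambda>x. \<theta> x (P s)) (at (\<gamma> s)) (\<gamma>' h) + \<theta> (\<gamma> s) (P' h))) (at s)"
    by simp
  moreover have "\<forall>\<^sub>F r in at s. \<gamma> r \<in> N"
    using has_derivative_continuous[OF \<gamma>] N
    by (metis continuous_within topological_tendstoD)
  then have "\<forall>\<^sub>F r in at s. (\<Sum>i\<in>UNIV. P r $ i * \<theta> (\<gamma> r) (axis i 1)) = \<theta> (\<gamma> r) (P r)"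
    by (rule eventually_mono) (rule expand[symmetric])
  ultimately show ?thesis
    by (rule has_derivative_transform_eventually) (simp_all add: expand[OF N(2), symmetric])
qed

context manifold3
begin

text \<open>The bracket is computed in the chart chosen at the point, since that is the chart in which
  tangent vectors there are represented.\<close>

definition lie_bracket :: "'a vfield \<Rightarrow> 'a vfield \<Rightarrow> 'a vfield" where
  "lie_bracket X Y q = (let c = pchart A q; x = coord c q in
     frechet_derivative (vfield_rep A c Y) (at x) (X q) -
     frechet_derivative (vfield_rep A c X) (at x) (Y q))"

lemma vfield_rep_pchart: "vfield_rep A (pchart A q) X (coord (pchart A q) q) = X q"
  by (simp add: vfield_rep_def Let_def inv_chart_coord pchart tchange_self)

lemma form1_rep_pchart: "form1_rep A (pchart A q) \<alpha> (coord (pchart A q) q) = \<alpha> q"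
  by (rule ext) (simp add: form1_rep_def Let_def inv_chart_coord pchart tchange_self)

lemma coord_pchart_in: "q \<in> U \<Longrightarrow> coord (pchart A q) q \<in> coord (pchart A q) ` (U \<inter> dom_chart (pchart A q))"
  using pchart by blast

lemma vfield_rep_has_derivative:
  assumes "smooth_vfield A U X" "q \<in> U"
  shows "(vfield_rep A (pchart A q) X has_derivative
    frechet_derivative (vfield_rep A (pchart A q) X) (at (coord (pchart A q) q))) (at (coord (pchart A q) q))"
  using assms pchart(1) coord_pchart_in[OF assms(2)]
  by (intro has_derivative_smooth_on) (auto simp: smooth_vfield_def)

lemma form1_rep_differentiable:
  assumes "smooth_form1 A U \<alpha>" "q \<in> U"
  shows "(\<lambda>x. form1_rep A (pchart A q) \<alpha> x w) differentiable (at (coord (pchart A q) q))"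
  using assms pchart(1) coord_pchart_in[OF assms(2)]
  by (intro smooth_on_differentiable) (auto simp: smooth_form1_def)

lemma vderiv_form_vfield:
  assumes U: "open U" "q \<in> U" and \<alpha>: "smooth_form1 A U \<alpha>" and X: "smooth_vfield A U X"
  defines "c \<equiv> pchart A q"
  shows "vderiv A Y (\<lambda>q. \<alpha> q (X q)) q
    = frechet_derivative (\<lambda>x. form1_rep A c \<alpha> x (X q)) (at (coord c q)) (Y q)
      + \<alpha> q (frechet_derivative (vfield_rep A c X) (at (coord c q)) (Y q))"
proof -
  let ?N = "coord c ` (U \<inter> dom_chart c)"
  have c: "c \<in> A" "q \<in> dom_chart c" unfolding c_def by (rule pchart)+
  note oN = open_coord_image[OF c(1) U(1)]
  have q: "coord c q \<in> ?N" using c U by blast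
  have "((\<lambda>x. form1_rep A c \<alpha> x (vfield_rep A c X x)) has_derivative
     (\<lambda>h. frechet_derivative (\<lambda>x. form1_rep A c \<alpha> x (vfield_rep A c X (coord c q))) (at (coord c q)) h
       + form1_rep A c \<alpha> (coord c q) (frechet_derivative (vfield_rep A c X) (at (coord c q)) h)))
     (at (coord c q))"
    by (rule has_derivative_linear_family[where \<gamma> = "\<lambda>x. x", OF oN q form1_rep_linear[OF \<alpha> c(1)]
          form1_rep_differentiable[OF \<alpha> U(2), folded c_def] has_derivative_ident
          vfield_rep_has_derivative[OF X U(2), folded c_def]])
  then have "((\<lambda>x. \<alpha> (inv_chart c x) (X (inv_chart c x))) has_derivative
     (\<lambda>h. frechet_derivative (\<lambda>x. form1_rep A c \<alpha> x (X q)) (at (coord c q)) h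
       + \<alpha> q (frechet_derivative (vfield_rep A c X) (at (coord c q)) h))) (at (coord c q))"
    unfolding vfield_rep_pchart[of q, folded c_def] form1_rep_pchart[of q, folded c_def]
    by (rule has_derivative_transform_within_open[OF _ oN q]) (auto intro: form1_rep_vfield_rep[OF c(1)])
  from vderiv_eqI[OF this[unfolded c_def]] show ?thesis by (simp add: c_def)
qed

text \<open>Cartan's formula for the exterior derivative: in the two derivatives of values of the form, the
  derivatives of the form itself make up \<open>d\<alpha>\<close> and those of the fields make up the bracket.\<close>

lemma ext_deriv_lie_bracket:
  assumes U: "open U" "q \<in> U" and \<alpha>: "smooth_form1 A U \<alpha>"
    and X: "smooth_vfield A U X" and Y: "smooth_vfield A U Y"
  shows "ext_deriv A \<alpha> q (X q) (Y q) = vderiv A X (\<lambda>q. \<alpha> q (Y q)) q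
    - vderiv A Y (\<lambda>q. \<alpha> q (X q)) q - \<alpha> q (lie_bracket X Y q)"
proof -
  have "linear (\<alpha> q)" using \<alpha> U(2) by (simp add: smooth_form1_def)
  then show ?thesis
    unfolding vderiv_form_vfield[OF U \<alpha> X] vderiv_form_vfield[OF U \<alpha> Y]
    by (simp add: ext_deriv_def lie_bracket_def Let_def linear_diff)
qed

text \<open>In \<open>X(Y(h)) - Y(X(h))\<close> the second derivatives of \<open>h\<close> cancel by symmetry.\<close>

lemma vderiv_commutator:
  assumes U: "open U" "q \<in> U" and h: "smooth_fun A U h"
    and X: "smooth_vfield A U X" and Y: "smooth_vfield A U Y"
  shows "vderiv A X (vderiv A Y h) q - vderiv A Y (vderiv A X h) q = vderiv A (lie_bracket X Y) h q"
proof -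
  define c where "c = pchart A q"
  let ?N = "coord c ` (U \<inter> dom_chart c)" and ?h = "h \<circ> inv_chart c"
  have c: "c \<in> A" "q \<in> dom_chart c" unfolding c_def by (rule pchart)+
  note oN = open_coord_image[OF c(1) U(1)]
  have q: "coord c q \<in> ?N" using c U by blast
  have hc: "smooth_on ?h ?N" using h c(1) by (simp add: smooth_fun_def)
  have lin: "linear (frechet_derivative ?h (at x))" if "x \<in> ?N" for x
    by (rule linear_frechet_derivative[OF smooth_on_differentiable[OF hc that]])
  have second: "vderiv A Z' (vderiv A Z h) q
      = frechet_derivative (\<lambda>x. frechet_derivative ?h (at x) (Z q)) (at (coord c q)) (Z' q)
       + frechet_derivative ?h (at (coord c q)) (frechet_derivative (vfield_rep A c Z) (at (coord c q)) (Z' q))"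
    if Z: "smooth_vfield A U Z" for Z Z'
  proof -
    have diff: "(\<lambda>x. frechet_derivative ?h (at x) w) differentiable (at (coord c q))" for w
      by (rule smooth_on_differentiable[OF smooth_on_frechet_derivative[OF hc] q])
    have "((\<lambda>x. frechet_derivative ?h (at x) (vfield_rep A c Z x)) has_derivative
     (\<lambda>w. frechet_derivative (\<lambda>x. frechet_derivative ?h (at x) (vfield_rep A c Z (coord c q))) (at (coord c q)) w
       + frechet_derivative ?h (at (coord c q)) (frechet_derivative (vfield_rep A c Z) (at (coord c q)) w)))
     (at (coord c q))"
      by (rule has_derivative_linear_family[where \<gamma> = "\<lambda>x. x", OF oN q lin diff
            has_derivative_ident vfield_rep_has_derivative[OF Z U(2), folded c_def]])
    then have "((\<lambda>x. vderiv A Z h (inv_chart c x)) has_derivative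
      (\<lambda>w. frechet_derivative (\<lambda>x. frechet_derivative ?h (at x) (Z q)) (at (coord c q)) w
       + frechet_derivative ?h (at (coord c q)) (frechet_derivative (vfield_rep A c Z) (at (coord c q)) w)))
      (at (coord c q))"
      unfolding vfield_rep_pchart[of q, folded c_def]
      by (rule has_derivative_transform_within_open[OF _ oN q]) (rule vderiv_rep[OF h c(1), symmetric])
    from vderiv_eqI[OF this[unfolded c_def]] show ?thesis by (simp add: c_def)
  qed
  show ?thesis
    unfolding second[OF X] second[OF Y]
    using second_derivative_symmetric_real[OF hc oN q, of "X q" "Y q"] linear_diff[OF lin[OF q]]
    by (simp add: vderiv_def lie_bracket_def Let_def flip: c_def)
qed

end

section \<open>Lie derivatives along a local flow\<close>

context manifold3
begin

context
  fixes V :: "'a vfield" and \<epsilon> :: real and W :: "'a set" and \<Phi> :: "real \<Rightarrow> 'a \<Rightarrow> 'a"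
  assumes flow: "local_flow A V \<epsilon> W \<Phi>"
begin

text \<open>The local flow \<open>flow_rep c\<close> in the chart \<open>c\<close>, a function of time and coordinates, is defined where
  the flow line starts in the chart and is in it again at the given time.\<close>

definition flow_dom :: "'a chart \<Rightarrow> (real \<times> (real^3)) set" where
  "flow_dom c = {(t, x). t \<in> {-\<epsilon><..<\<epsilon>} \<and> x \<in> coord c ` (W \<inter> dom_chart c) \<and>
                 \<Phi> t (inv_chart c x) \<in> dom_chart c}"

definition flow_rep :: "'a chart \<Rightarrow> real \<times> (real^3) \<Rightarrow> real^3" where
  "flow_rep c = (\<lambda>(t, x). coord c (\<Phi> t (inv_chart c x)))"

lemma flow_open: "open W" and flow_pos: "0 < \<epsilon>"
  using flow by (auto simp: local_flow_def)

lemma flow_zero: "q \<in> W \<Longrightarrow> \<Phi> 0 q = q"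
  using flow by (auto simp: local_flow_def)

lemma flow_continuous: "continuous_on ({-\<epsilon><..<\<epsilon>} \<times> W) (\<lambda>(t, q). \<Phi> t q)"
  using flow by (auto simp: local_flow_def)

lemma flow_integral_curve:
  "t \<in> {-\<epsilon><..<\<epsilon>} \<Longrightarrow> q \<in> W \<Longrightarrow>
    ((\<lambda>s. coord (pchart A (\<Phi> t q)) (\<Phi> s q)) has_vector_derivative V (\<Phi> t q)) (at t)"
  using flow unfolding local_flow_def by blast

lemma smooth_flow_rep: "c \<in> A \<Longrightarrow> smooth_on (flow_rep c) (flow_dom c)"
  using flow by (auto simp: local_flow_def flow_rep_def flow_dom_def)

lemma open_flow_dom:
  assumes c: "c \<in> A"
  shows "open (flow_dom c)"
proof -
  let ?N = "coord c ` (W \<inter> dom_chart c)"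
  have "continuous_on ({-\<epsilon><..<\<epsilon>} \<times> ?N) (\<lambda>z. (fst z, inv_chart c (snd z)))"
    by (intro continuous_intros continuous_on_compose2[OF continuous_inv_chart[OF c]]) auto
  moreover have "(\<lambda>z. (fst z, inv_chart c (snd z))) ` ({-\<epsilon><..<\<epsilon>} \<times> ?N) \<subseteq> {-\<epsilon><..<\<epsilon>} \<times> W"
    by (auto simp: inv_chart_coord[OF c])
  ultimately have "continuous_on ({-\<epsilon><..<\<epsilon>} \<times> ?N) (\<lambda>z. \<Phi> (fst z) (inv_chart c (snd z)))"
    using continuous_on_compose2[OF flow_continuous] by force
  from continuous_open_preimage[OF this _ open_dom[OF c]]
  have "open ({-\<epsilon><..<\<epsilon>} \<times> ?N \<inter> (\<lambda>z. \<Phi> (fst z) (inv_chart c (snd z))) -` dom_chart c)"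
    using open_coord_image[OF c flow_open] by (metis open_Times open_greaterThanLessThan)
  also have "{-\<epsilon><..<\<epsilon>} \<times> ?N \<inter> (\<lambda>z. \<Phi> (fst z) (inv_chart c (snd z))) -` dom_chart c = flow_dom c"
    by (auto simp: flow_dom_def)
  finally show ?thesis .
qed

lemma flow_dom_zero: "c \<in> A \<Longrightarrow> x \<in> coord c ` (W \<inter> dom_chart c) \<Longrightarrow> (0, x) \<in> flow_dom c"
  using flow_pos by (auto simp: flow_dom_def inv_chart_coord flow_zero)

lemma open_flow_times:
  assumes "q \<in> W" "open X"
  shows "open {t \<in> {-\<epsilon><..<\<epsilon>}. \<Phi> t q \<in> X}"
proof -
  have "continuous_on {-\<epsilon><..<\<epsilon>} (\<lambda>t. (t, q))" by (intro continuous_intros)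
  from continuous_on_compose2[OF flow_continuous this] assms(1)
  have "continuous_on {-\<epsilon><..<\<epsilon>} (\<lambda>t. \<Phi> t q)" by auto
  from continuous_open_preimage[OF this _ assms(2)]
  show ?thesis by (simp add: vimage_def Int_def)
qed

lemma has_derivative_flow_rep:
  "c \<in> A \<Longrightarrow> z \<in> flow_dom c \<Longrightarrow>
    (flow_rep c has_derivative frechet_derivative (flow_rep c) (at z)) (at z)"
  by (rule has_derivative_smooth_on[OF smooth_flow_rep])

lemma flow_rep_time_derivative:
  assumes c: "c \<in> A" and x: "x \<in> coord c ` (W \<inter> dom_chart c)"
  shows "frechet_derivative (flow_rep c) (at (0, x)) (1, 0) = vfield_rep A c V x"
proof -
  obtain q where q: "q \<in> W" "q \<in> dom_chart c" "x = coord c q" using x by auto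
  define b where "b = pchart A q"
  have b: "b \<in> A" "q \<in> dom_chart b" unfolding b_def by (rule pchart)+
  have "((\<lambda>s. coord (pchart A (\<Phi> 0 q)) (\<Phi> s q)) has_vector_derivative V (\<Phi> 0 q)) (at 0)"
    by (rule flow_integral_curve) (use q(1) flow_pos in auto)
  then have "((\<lambda>s. coord b (\<Phi> s q)) has_derivative (\<lambda>s. s *\<^sub>R V q)) (at 0)"
    by (simp add: flow_zero[OF q(1)] b_def has_vector_derivative_def)
  moreover have "((coord c \<circ> inv_chart b) has_derivative tchange b c q) (at (coord b (\<Phi> 0 q)))"
    using transition_has_derivative[OF b(1) c b(2) q(2)] by (simp add: flow_zero[OF q(1)])
  ultimately have "((\<lambda>s. (coord c \<circ> inv_chart b) (coord b (\<Phi> s q))) has_derivative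
      (\<lambda>s. tchange b c q (s *\<^sub>R V q))) (at 0)"
    by (rule has_derivative_compose)
  then have "((\<lambda>s. flow_rep c (s, x)) has_derivative (\<lambda>s. tchange b c q (s *\<^sub>R V q))) (at 0)"
  proof (rule has_derivative_transform_within_open)
    show "open {t \<in> {-\<epsilon><..<\<epsilon>}. \<Phi> t q \<in> dom_chart b}"
      by (rule open_flow_times[OF q(1) open_dom[OF b(1)]])
    show "0 \<in> {t \<in> {-\<epsilon><..<\<epsilon>}. \<Phi> t q \<in> dom_chart b}"
      using flow_pos b(2) by (simp add: flow_zero[OF q(1)])
  qed (simp add: flow_rep_def q(3) inv_chart_coord[OF c q(2)] inv_chart_coord[OF b(1)])
  moreover have "((\<lambda>s. flow_rep c (s, x)) has_derivative
      (\<lambda>s. frechet_derivative (flow_rep c) (at (0, x)) (s, 0))) (at 0)"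
  proof -
    have "((\<lambda>s. (s, x)) has_derivative (\<lambda>s. (s, 0))) (at 0)"
      by (auto intro!: derivative_eq_intros)
    from has_derivative_compose[OF this has_derivative_flow_rep[OF c flow_dom_zero[OF c x]]]
    show ?thesis .
  qed
  ultimately have "(\<lambda>s. tchange b c q (s *\<^sub>R V q))
      = (\<lambda>s. frechet_derivative (flow_rep c) (at (0, x)) (s, 0))"
    by (rule has_derivative_unique)
  from fun_cong[OF this, of 1] show ?thesis
    by (simp add: vfield_rep_def Let_def q(3) inv_chart_coord[OF c q(2)] b_def)
qed

text \<open>The differential of the flow maps is the spatial derivative of the flow in a fixed chart, up to
  the change to the chart chosen at the end point.\<close>

lemma tangent_map_flow:
  assumes q: "q \<in> W" and t: "t \<in> {-\<epsilon><..<\<epsilon>}" "\<Phi> t q \<in> dom_chart (pchart A q)"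
  defines "c \<equiv> pchart A q"
  shows "tangent_map A (\<Phi> t) q w = tchange c (pchart A (\<Phi> t q)) (\<Phi> t q)
    (frechet_derivative (flow_rep c) (at (t, coord c q)) (0, w))"
proof -
  define d where "d = pchart A (\<Phi> t q)"
  have c: "c \<in> A" "q \<in> dom_chart c" and d: "d \<in> A" "\<Phi> t q \<in> dom_chart d"
    unfolding c_def d_def by (rule pchart)+
  have t': "\<Phi> t q \<in> dom_chart c" using t(2) by (simp add: c_def)
  have z: "(t, coord c q) \<in> flow_dom c"
    using q t(1) t' c by (auto simp: flow_dom_def inv_chart_coord)
  have rep: "flow_rep c (t, coord c q) = coord c (\<Phi> t q)"
    by (simp add: flow_rep_def inv_chart_coord[OF c])
  have "((\<lambda>x. (t, x)) has_derivative (\<lambda>w. (0, w))) (at (coord c q))"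
    by (auto intro!: derivative_eq_intros)
  from has_derivative_compose[OF this has_derivative_flow_rep[OF c(1) z]]
  have "((\<lambda>x. flow_rep c (t, x)) has_derivative
      (\<lambda>w. frechet_derivative (flow_rep c) (at (t, coord c q)) (0, w))) (at (coord c q))" .
  moreover have "((coord d \<circ> inv_chart c) has_derivative tchange c d (\<Phi> t q))
      (at (flow_rep c (t, coord c q)))"
    unfolding rep by (rule transition_has_derivative[OF c(1) d(1) t' d(2)])
  ultimately have "((\<lambda>x. (coord d \<circ> inv_chart c) (flow_rep c (t, x))) has_derivative
      (\<lambda>w. tchange c d (\<Phi> t q) (frechet_derivative (flow_rep c) (at (t, coord c q)) (0, w))))
      (at (coord c q))"
    by (rule has_derivative_compose)
  then have "((coord d \<circ> \<Phi> t \<circ> inv_chart c) has_derivative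
      (\<lambda>w. tchange c d (\<Phi> t q) (frechet_derivative (flow_rep c) (at (t, coord c q)) (0, w))))
      (at (coord c q))"
  proof (rule has_derivative_transform_within_open)
    have "Pair t -` flow_dom c = {x. (t, x) \<in> flow_dom c}" by auto
    then show "open {x. (t, x) \<in> flow_dom c}"
      using open_vimage[OF open_flow_dom[OF c(1)], of "Pair t"] by (simp add: continuous_on_Pair)
  qed (use z in \<open>auto simp: flow_rep_def flow_dom_def inv_chart_coord[OF c(1)]\<close>)
  from frechet_derivative_eqI[OF this] show ?thesis
    by (simp add: tangent_map_def Let_def c_def[symmetric] d_def[symmetric])
qed

text \<open>The Lie derivative \<open>L\<^sub>V\<alpha> = i\<^sub>Vd\<alpha> + d(\<alpha>(V))\<close> as the derivative at time 0 of the pullbacks of \<open>\<alpha>\<close> along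
  the flow.  The only derivative of the flow that is not given by \<open>V\<close> directly is the mixed one, in
  time and space; exchanging the order turns it into the derivative of the representative of \<open>V\<close>.\<close>

lemma has_real_derivative_form_flow:
  assumes U: "open U" "q \<in> U" and q: "q \<in> W"
    and \<alpha>: "smooth_form1 A U \<alpha>" and V: "smooth_vfield A U V"
  shows "((\<lambda>t. \<alpha> (\<Phi> t q) (tangent_map A (\<Phi> t) q w)) has_real_derivative
     ext_deriv A \<alpha> q (V q) w + vderiv A (\<lambda>_. w) (\<lambda>q. \<alpha> q (V q)) q) (at 0)"
proof -
  define c x \<psi> where "c = pchart A q" and "x = coord c q" and "\<psi> = flow_rep c"
  let ?N = "coord c ` (U \<inter> dom_chart c)" and ?D = "\<lambda>z. frechet_derivative \<psi> (at z)"
  let ?V = "vfield_rep A c V"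
  have c: "c \<in> A" "q \<in> dom_chart c" unfolding c_def by (rule pchart)+
  note oN = open_coord_image[OF c(1) U(1)]
  have xW: "x \<in> coord c ` (W \<inter> dom_chart c)" using c q by (auto simp: x_def)
  have z: "(0, x) \<in> flow_dom c" by (rule flow_dom_zero[OF c(1) xW])
  note oW = open_coord_image[OF c(1) flow_open]
  have lin: "linear (?D (0, x))"
    using has_derivative_linear[OF has_derivative_flow_rep[OF c(1) z]] by (simp add: \<psi>_def)
  have zero: "\<psi> (0, y) = y" if "y \<in> coord c ` (W \<inter> dom_chart c)" for y
    using that by (auto simp: \<psi>_def flow_rep_def inv_chart_coord[OF c(1)] flow_zero)
  have axis: "?D (0, x) (h, 0) = h *\<^sub>R V q" for h
    using linear_scale[OF lin, of h "(1, 0)"] flow_rep_time_derivative[OF c(1) xW]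
      vfield_rep_pchart[of q V]
    by (simp add: \<psi>_def x_def c_def)
  have slice: "((\<lambda>y. (0, y)) has_derivative (\<lambda>w. (0, w))) (at x)"
    by (auto intro!: derivative_eq_intros)
  have "((\<lambda>y. \<psi> (0, y)) has_derivative (\<lambda>w. ?D (0, x) (0, w))) (at x)"
    unfolding \<psi>_def by (rule has_derivative_compose[OF slice has_derivative_flow_rep[OF c(1) z]])
  then have "((\<lambda>y. y) has_derivative (\<lambda>w. ?D (0, x) (0, w))) (at x)"
    by (rule has_derivative_transform_within_open[OF _ oW xW]) (rule zero)
  from has_derivative_unique[OF this has_derivative_ident]
  have space: "?D (0, x) (0, w) = w" by metis
  \<comment> \<open>at time 0 the time derivative of the flow is \<open>V\<close> at every point near \<open>x\<close>, so its spatial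
    derivative is that of \<open>V\<close>; by symmetry this is the time derivative of the spatial derivative\<close>
  have D2: "smooth_on (\<lambda>z. ?D z v) (flow_dom c)" for v
    unfolding \<psi>_def by (rule smooth_on_frechet_derivative[OF smooth_flow_rep[OF c(1)]])
  have "((\<lambda>y. ?D (0, y) (1, 0)) has_derivative
      (\<lambda>w. frechet_derivative (\<lambda>z. ?D z (1, 0)) (at (0, x)) (0, w))) (at x)"
    by (rule has_derivative_compose[OF slice has_derivative_smooth_on[OF D2 z]])
  then have "(?V has_derivative (\<lambda>w. frechet_derivative (\<lambda>z. ?D z (1, 0)) (at (0, x)) (0, w))) (at x)"
    by (rule has_derivative_transform_within_open[OF _ oW xW])
      (simp add: \<psi>_def flow_rep_time_derivative[OF c(1)])
  from frechet_derivative_eqI[OF this]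
  have mixed: "frechet_derivative (\<lambda>z. ?D z (0, w)) (at (0, x)) (1, 0) = frechet_derivative ?V (at x) w"
    using second_derivative_symmetric[OF smooth_flow_rep[OF c(1)] open_flow_dom[OF c(1)] z,
        of "(0, w)" "(1, 0)"]
    by (simp add: \<psi>_def)
  have lin2: "linear (frechet_derivative (\<lambda>z. ?D z (0, w)) (at (0, x)))"
    by (rule linear_frechet_derivative[OF smooth_on_differentiable[OF D2 z]])
  have mixed': "frechet_derivative (\<lambda>z. ?D z (0, w)) (at (0, x)) (h, 0)
      = h *\<^sub>R frechet_derivative ?V (at x) w" for h
    using linear_scale[OF lin2, of h "(1, 0)"] mixed by simp
  have time: "((\<lambda>t. (t, x)) has_derivative (\<lambda>h. (h, 0))) (at 0)"
    by (auto intro!: derivative_eq_intros)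
  have \<gamma>: "((\<lambda>t. \<psi> (t, x)) has_derivative (\<lambda>h. h *\<^sub>R V q)) (at 0)"
    using has_derivative_compose[OF time has_derivative_flow_rep[OF c(1) z]]
    by (simp add: \<psi>_def[symmetric] axis)
  have P: "((\<lambda>t. ?D (t, x) (0, w)) has_derivative (\<lambda>h. h *\<^sub>R frechet_derivative ?V (at x) w)) (at 0)"
    using has_derivative_compose[OF time has_derivative_smooth_on[OF D2[of "(0, w)"] z]]
    unfolding mixed' .
  have x0: "\<psi> (0, x) = x" by (rule zero[OF xW])
  have xN: "\<psi> (0, x) \<in> ?N" unfolding x0 using c U by (auto simp: x_def)
  have diff: "(\<lambda>y. form1_rep A c \<alpha> y v) differentiable (at (\<psi> (0, x)))" for v
    unfolding x0 unfolding x_def c_def by (rule form1_rep_differentiable[OF \<alpha> U(2)])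
  have lin\<alpha>: "linear (\<alpha> q)" using \<alpha> U by (simp add: smooth_form1_def)
  have lin\<theta>: "linear (frechet_derivative (\<lambda>y. form1_rep A c \<alpha> y w) (at x))"
    using linear_frechet_derivative[OF diff] by (simp add: x0)
  have rep: "form1_rep A c \<alpha> x = \<alpha> q" unfolding x_def c_def by (rule form1_rep_pchart)
  have "((\<lambda>t. form1_rep A c \<alpha> (\<psi> (t, x)) (?D (t, x) (0, w))) has_derivative
      (\<lambda>h. frechet_derivative (\<lambda>y. form1_rep A c \<alpha> y (?D (0, x) (0, w))) (at (\<psi> (0, x))) (h *\<^sub>R V q)
        + form1_rep A c \<alpha> (\<psi> (0, x)) (h *\<^sub>R frechet_derivative ?V (at x) w))) (at 0)"
    by (rule has_derivative_linear_family[OF oN xN form1_rep_linear[OF \<alpha> c(1)] diff \<gamma> P])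
  then have "((\<lambda>t. form1_rep A c \<alpha> (\<psi> (t, x)) (?D (t, x) (0, w))) has_derivative
      (\<lambda>h. (frechet_derivative (\<lambda>y. form1_rep A c \<alpha> y w) (at x) (V q)
        + \<alpha> q (frechet_derivative ?V (at x) w)) * h)) (at 0)"
    by (simp add: x0 space rep linear_scale[OF lin\<alpha>] linear_scale[OF lin\<theta>] algebra_simps)
  then have "((\<lambda>t. \<alpha> (\<Phi> t q) (tangent_map A (\<Phi> t) q w)) has_derivative
      (\<lambda>h. (frechet_derivative (\<lambda>y. form1_rep A c \<alpha> y w) (at x) (V q)
        + \<alpha> q (frechet_derivative ?V (at x) w)) * h)) (at 0)"
  proof (rule has_derivative_transform_within_open)
    show "open {t \<in> {-\<epsilon><..<\<epsilon>}. \<Phi> t q \<in> dom_chart c}"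
      by (rule open_flow_times[OF q open_dom[OF c(1)]])
    show "0 \<in> {t \<in> {-\<epsilon><..<\<epsilon>}. \<Phi> t q \<in> dom_chart c}"
      using flow_pos c(2) by (simp add: flow_zero[OF q])
    fix t assume t: "t \<in> {t \<in> {-\<epsilon><..<\<epsilon>}. \<Phi> t q \<in> dom_chart c}"
    then have "\<psi> (t, x) = coord c (\<Phi> t q)"
      by (simp add: \<psi>_def flow_rep_def x_def inv_chart_coord[OF c])
    then show "form1_rep A c \<alpha> (\<psi> (t, x)) (?D (t, x) (0, w)) = \<alpha> (\<Phi> t q) (tangent_map A (\<Phi> t) q w)"
      using t tangent_map_flow[OF q, of t w] inv_chart_coord[OF c(1), of "\<Phi> t q"]
      by (simp add: form1_rep_def Let_def \<psi>_def x_def c_def[symmetric])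
  qed
  moreover have "ext_deriv A \<alpha> q (V q) w + vderiv A (\<lambda>_. w) (\<lambda>q. \<alpha> q (V q)) q
      = frechet_derivative (\<lambda>y. form1_rep A c \<alpha> y w) (at x) (V q) + \<alpha> q (frechet_derivative ?V (at x) w)"
    unfolding vderiv_form_vfield[OF U \<alpha> V] by (simp add: ext_deriv_def Let_def x_def c_def)
  ultimately show ?thesis by (simp add: has_field_derivative_def)
qed

end

end

section \<open>Derivations and the structure equations of a contact frame\<close>

text \<open>Smooth functions on an open set \<open>S\<close> are represented by functions on the whole type, whose values
  outside \<open>S\<close> are arbitrary.  For this reason all identities are asserted on \<open>S\<close> only, and a
  derivation is required to respect equality on \<open>S\<close>.\<close>

locale function_algebra =
  fixes F :: "('a \<Rightarrow> real) set" and S :: "'a set"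
  assumes const_mem [simp]: "(\<lambda>_. k) \<in> F"
    and add_mem [simp]: "f \<in> F \<Longrightarrow> h \<in> F \<Longrightarrow> (\<lambda>q. f q + h q) \<in> F"
    and mult_mem [simp]: "f \<in> F \<Longrightarrow> h \<in> F \<Longrightarrow> (\<lambda>q. f q * h q) \<in> F"
begin

lemma minus_mem [simp]: "f \<in> F \<Longrightarrow> (\<lambda>q. - f q) \<in> F"
  using mult_mem[OF const_mem[of "-1"]] by simp

lemma diff_mem [simp]: "f \<in> F \<Longrightarrow> h \<in> F \<Longrightarrow> (\<lambda>q. f q - h q) \<in> F"
  using add_mem[OF _ minus_mem] by simp

definition derivation :: "(('a \<Rightarrow> real) \<Rightarrow> 'a \<Rightarrow> real) \<Rightarrow> bool" where
  "derivation D \<longleftrightarrow> (\<forall>f\<in>F. D f \<in> F) \<and> (\<forall>k. \<forall>q\<in>S. D (\<lambda>_. k) q = 0) \<and>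
     (\<forall>f\<in>F. \<forall>h\<in>F. \<forall>q\<in>S. D (\<lambda>q. f q + h q) q = D f q + D h q \<and>
        D (\<lambda>q. f q * h q) q = f q * D h q + D f q * h q) \<and>
     (\<forall>f h. (\<forall>q\<in>S. f q = h q) \<longrightarrow> (\<forall>q\<in>S. D f q = D h q))"

lemma derivation_mem: "derivation D \<Longrightarrow> f \<in> F \<Longrightarrow> D f \<in> F"
  by (simp add: derivation_def)

lemma derivation_cong:
  "derivation D \<Longrightarrow> (\<And>q. q \<in> S \<Longrightarrow> f q = h q) \<Longrightarrow> q \<in> S \<Longrightarrow> D f q = D h q"
  by (simp add: derivation_def)

lemma derivation_const: "derivation D \<Longrightarrow> q \<in> S \<Longrightarrow> D (\<lambda>_. k) q = 0"
  by (simp add: derivation_def)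

lemma derivation_add:
  "derivation D \<Longrightarrow> f \<in> F \<Longrightarrow> h \<in> F \<Longrightarrow> q \<in> S \<Longrightarrow> D (\<lambda>q. f q + h q) q = D f q + D h q"
  by (simp add: derivation_def)

lemma derivation_mult:
  "derivation D \<Longrightarrow> f \<in> F \<Longrightarrow> h \<in> F \<Longrightarrow> q \<in> S \<Longrightarrow>
    D (\<lambda>q. f q * h q) q = f q * D h q + D f q * h q"
  by (simp add: derivation_def)

lemma derivation_minus:
  "derivation D \<Longrightarrow> f \<in> F \<Longrightarrow> q \<in> S \<Longrightarrow> D (\<lambda>q. - f q) q = - D f q"
  using derivation_mult[OF _ const_mem[of "-1"], of D f q] derivation_const[of D q "-1"] by simp

lemma derivation_diff:
  "derivation D \<Longrightarrow> f \<in> F \<Longrightarrow> h \<in> F \<Longrightarrow> q \<in> S \<Longrightarrow> D (\<lambda>q. f q - h q) q = D f q - D h q"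
  using derivation_add[OF _ _ minus_mem, of D f h q] derivation_minus[of D h q] by simp

lemmas derivation_rules = derivation_mem derivation_const derivation_add derivation_mult
  derivation_minus derivation_diff

definition commutator ::
  "(('a \<Rightarrow> real) \<Rightarrow> 'a \<Rightarrow> real) \<Rightarrow> (('a \<Rightarrow> real) \<Rightarrow> 'a \<Rightarrow> real) \<Rightarrow> ('a \<Rightarrow> real) \<Rightarrow> 'a \<Rightarrow> real" where
  "commutator D D' h q = D (D' h) q - D' (D h) q"

lemma commutator_swap: "commutator D D' h q = - commutator D' D h q"
  by (simp add: commutator_def)

lemma commutator_self: "commutator D D h q = 0"
  by (simp add: commutator_def)

lemma commutator_fun: "commutator D D' h = (\<lambda>q. D (D' h) q - D' (D h) q)"
  by (simp add: fun_eq_iff commutator_def)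

lemma jacobi:
  assumes "derivation D1" "derivation D2" "derivation D3" "h \<in> F" "q \<in> S"
  shows "commutator D1 (commutator D2 D3) h q + commutator D2 (commutator D3 D1) h q
    + commutator D3 (commutator D1 D2) h q = 0"
  unfolding commutator_def[of _ "commutator _ _"] unfolding commutator_fun
  using assms(4,5) by (simp add: derivation_rules[OF assms(1)] derivation_rules[OF assms(2)]
      derivation_rules[OF assms(3)])

end

text \<open>The structure equations of the coframe in dual form: the coefficients of \<open>[E\<^sub>i, E\<^sub>j]\<close> are the
  negatives of those of \<open>\<eta>\<^sup>i \<and> \<eta>\<^sup>j\<close>, and \<open>c123\<close> stands for \<open>C\<^sup>1\<^sub>2\<^sub>3\<close>.
  The last assumption says that there are enough functions to read off the coefficients of an
  operator in the frame.\<close>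

locale contact_frame = function_algebra F S
  for F :: "('a \<Rightarrow> real) set" and S :: "'a set" +
  fixes E1 E2 E3 :: "('a \<Rightarrow> real) \<Rightarrow> 'a \<Rightarrow> real"
    and c123 c131 c112 c223 c231 c212 :: "'a \<Rightarrow> real"
  assumes frame [simp]: "derivation E1" "derivation E2" "derivation E3"
    and coeffs [simp]: "c123 \<in> F" "c131 \<in> F" "c112 \<in> F" "c223 \<in> F" "c231 \<in> F" "c212 \<in> F"
    and comm23: "h \<in> F \<Longrightarrow> q \<in> S \<Longrightarrow> commutator E2 E3 h q = - c123 q * E1 h q - c223 q * E2 h q"
    and comm31: "h \<in> F \<Longrightarrow> q \<in> S \<Longrightarrow> commutator E3 E1 h q = - c131 q * E1 h q - c231 q * E2 h q"
    and comm12: "h \<in> F \<Longrightarrow> q \<in> S \<Longrightarrow>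
      commutator E1 E2 h q = - c112 q * E1 h q - c212 q * E2 h q - E3 h q"
    and separating: "q \<in> S \<Longrightarrow> (\<And>h. h \<in> F \<Longrightarrow> a * E1 h q + b * E2 h q + c * E3 h q = 0) \<Longrightarrow>
      a = 0 \<and> b = 0 \<and> c = 0"
begin

lemmas frame_rules [simp] = derivation_rules[OF frame(1)] derivation_rules[OF frame(2)]
  derivation_rules[OF frame(3)]

text \<open>The bracket with \<open>X = a E\<^sub>1 + b E\<^sub>2 + c E\<^sub>3\<close>; all later computations reduce to this lemma, the
  Jacobi identity and comparison of coefficients.\<close>

lemma commutator_combination:
  assumes D: "derivation D" and abc: "a \<in> F" "b \<in> F" "c \<in> F" and h: "h \<in> F" "q \<in> S"
    and X: "\<And>h q. h \<in> F \<Longrightarrow> q \<in> S \<Longrightarrow> X h q = a q * E1 h q + b q * E2 h q + c q * E3 h q"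
  shows "commutator D X h q = D a q * E1 h q + D b q * E2 h q + D c q * E3 h q
    + a q * commutator D E1 h q + b q * commutator D E2 h q + c q * commutator D E3 h q"
proof -
  have "D (X h) q = D (\<lambda>q. a q * E1 h q + b q * E2 h q + c q * E3 h q) q"
    using X[OF h(1)] by (intro derivation_cong[OF D _ h(2)])
  then show ?thesis
    using abc h X[OF derivation_mem[OF D h(1)] h(2)]
    by (simp add: commutator_def derivation_rules[OF D] algebra_simps)
qed

text \<open>This is \<open>d d\<eta>\<^sup>3 = 0\<close>, that is, the coefficient of \<open>E\<^sub>3\<close> in the Jacobi identity of the frame.  Only
  \<open>[E\<^sub>1, E\<^sub>2]\<close> has a component along \<open>E\<^sub>3\<close>, so \<open>[E\<^sub>1, [E\<^sub>2, E\<^sub>3]]\<close> contributes \<open>c223\<close> and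
  \<open>[E\<^sub>2, [E\<^sub>3, E\<^sub>1]]\<close> contributes \<open>- c131\<close>.\<close>

lemma c223_eq: "q \<in> S \<Longrightarrow> c223 q = c131 q"
proof -
  assume q: "q \<in> S"
  have "(E1 (\<lambda>q. - c123 q) q + E2 (\<lambda>q. - c131 q) q + E3 (\<lambda>q. - c112 q) q
        + (c223 q - c131 q) * c112 q + c112 q * c131 q - c212 q * c123 q) * E1 h q
      + (E1 (\<lambda>q. - c223 q) q + E2 (\<lambda>q. - c231 q) q + E3 (\<lambda>q. - c212 q) q
        + (c223 q - c131 q) * c212 q + c112 q * c231 q - c212 q * c223 q) * E2 h q + (c223 q - c131 q) * E3 h q = 0"
    if h: "h \<in> F" for h
  proof -
    have "commutator E1 (commutator E2 E3) h q = E1 (\<lambda>q. - c123 q) q * E1 h q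
      + E1 (\<lambda>q. - c223 q) q * E2 h q + E1 (\<lambda>q. 0) q * E3 h q
      + - c123 q * commutator E1 E1 h q + - c223 q * commutator E1 E2 h q + 0 * commutator E1 E3 h q"
      by (rule commutator_combination) (use h q comm23 in simp_all)
    moreover have "commutator E2 (commutator E3 E1) h q = E2 (\<lambda>q. - c131 q) q * E1 h q
      + E2 (\<lambda>q. - c231 q) q * E2 h q + E2 (\<lambda>q. 0) q * E3 h q
      + - c131 q * commutator E2 E1 h q + - c231 q * commutator E2 E2 h q + 0 * commutator E2 E3 h q"
      by (rule commutator_combination) (use h q comm31 in simp_all)
    moreover have "commutator E3 (commutator E1 E2) h q = E3 (\<lambda>q. - c112 q) q * E1 h q
      + E3 (\<lambda>q. - c212 q) q * E2 h q + E3 (\<lambda>q. -1) q * E3 h q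
      + - c112 q * commutator E3 E1 h q + - c212 q * commutator E3 E2 h q + -1 * commutator E3 E3 h q"
      by (rule commutator_combination) (use h q comm12 in simp_all)
    ultimately show ?thesis
      using jacobi[OF frame h q] comm12[OF h q] comm23[OF h q] comm31[OF h q] q h
        commutator_swap[of E2 E1 h q] commutator_swap[of E3 E2 h q]
      by (simp add: commutator_self algebra_simps)
  qed
  from separating[OF q this] show "c223 q = c131 q" by simp
qed

end

text \<open>The components \<open>v1\<close>, \<open>v2\<close>, \<open>f\<close> of a symmetry.  The first two equations say that \<open>L\<^sub>V\<eta>\<^sup>3\<close> vanishes on
  \<open>E\<^sub>1\<close> and \<open>E\<^sub>2\<close>; the others say that the matrix of \<open>(L\<^sub>V\<eta>\<^sup>1, L\<^sub>V\<eta>\<^sup>2)\<close> on \<open>(E\<^sub>1, E\<^sub>2)\<close> is skew.\<close>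

locale contact_symmetry = contact_frame F S E1 E2 E3 c123 c131 c112 c223 c231 c212
  for F :: "('a \<Rightarrow> real) set" and S :: "'a set" and E1 E2 E3 c123 c131 c112 c223 c231 c212 +
  fixes v1 v2 f :: "'a \<Rightarrow> real"
  assumes comps [simp]: "v1 \<in> F" "v2 \<in> F" "f \<in> F"
    and E1_f: "q \<in> S \<Longrightarrow> E1 f q = v2 q" and E2_f: "q \<in> S \<Longrightarrow> E2 f q = - v1 q"
    and E1_v1: "q \<in> S \<Longrightarrow> E1 v1 q = c112 q * v2 q - c131 q * f q"
    and E2_v2: "q \<in> S \<Longrightarrow> E2 v2 q = c223 q * f q - c212 q * v1 q"
    and shear: "q \<in> S \<Longrightarrow> (E2 v1 q - c123 q * f q + c112 q * v1 q)
      + (E1 v2 q + c231 q * f q - c212 q * v2 q) = 0"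
begin

text \<open>By the first two equations \<open>[E\<^sub>1, E\<^sub>2]f = - E\<^sub>1v\<^sub>1 - E\<^sub>2v\<^sub>2\<close>, and this equals
  \<open>- c112 E\<^sub>1f - c212 E\<^sub>2f\<close> by the equations for the diagonal of the skew matrix and \<open>c223 = c131\<close>;
  in the commutator relation only \<open>- E\<^sub>3f\<close> is left.\<close>

lemma E3_f: "q \<in> S \<Longrightarrow> E3 f q = 0"
proof -
  assume q: "q \<in> S"
  have "E1 (E2 f) q = E1 (\<lambda>q. - v1 q) q" by (rule derivation_cong) (auto simp: E2_f q)
  moreover have "E2 (E1 f) q = E2 v2 q" by (rule derivation_cong) (auto simp: E1_f q)
  ultimately show ?thesis
    using comm12[OF comps(3) q] c223_eq[OF q]
    by (simp add: commutator_def q E1_v1 E2_v2 E1_f E2_f algebra_simps)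
qed

text \<open>Since \<open>E\<^sub>3f = 0\<close>, the commutators \<open>[E\<^sub>2, E\<^sub>3]f\<close> and \<open>[E\<^sub>3, E\<^sub>1]f\<close> are the derivatives of \<open>v\<^sub>1\<close> and
  \<open>v\<^sub>2\<close> along \<open>E\<^sub>3\<close>.  These two equations amount to \<open>L\<^sub>V\<eta>\<^sup>1\<close> and \<open>L\<^sub>V\<eta>\<^sup>2\<close> vanishing on \<open>E\<^sub>3\<close>.\<close>

lemma E3_v1: "q \<in> S \<Longrightarrow> E3 v1 q = c223 q * v1 q - c123 q * v2 q"
proof -
  assume q: "q \<in> S"
  have "E2 (E3 f) q = E2 (\<lambda>q. 0) q" by (rule derivation_cong) (auto simp: E3_f q)
  moreover have "E3 (E2 f) q = E3 (\<lambda>q. - v1 q) q" by (rule derivation_cong) (auto simp: E2_f q)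
  ultimately show ?thesis
    using comm23[OF comps(3) q] by (simp add: commutator_def q E1_f E2_f algebra_simps)
qed

lemma E3_v2: "q \<in> S \<Longrightarrow> E3 v2 q = c231 q * v1 q - c131 q * v2 q"
proof -
  assume q: "q \<in> S"
  have "E1 (E3 f) q = E1 (\<lambda>q. 0) q" by (rule derivation_cong) (auto simp: E3_f q)
  moreover have "E3 (E1 f) q = E3 v2 q" by (rule derivation_cong) (auto simp: E1_f q)
  ultimately show ?thesis
    using comm31[OF comps(3) q] by (simp add: commutator_def q E1_f E2_f algebra_simps)
qed

definition V :: "('a \<Rightarrow> real) \<Rightarrow> 'a \<Rightarrow> real" where
  "V h q = v1 q * E1 h q + v2 q * E2 h q + f q * E3 h q"

lemma derivation_V [simp]: "derivation V"
  unfolding derivation_def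
proof (intro conjI ballI allI impI)
  show "V h \<in> F" if "h \<in> F" for h
    unfolding V_def[abs_def] using that by simp
  show "V h q = V k q" if "\<forall>q\<in>S. h q = k q" "q \<in> S" for h k q
    using that frame[THEN derivation_cong, of h k q] by (simp add: V_def)
qed (simp_all add: V_def algebra_simps)

lemmas V_rules [simp] = derivation_rules[OF derivation_V]

text \<open>The speed of rotation, \<open>(L\<^sub>V\<eta>\<^sup>1)(E\<^sub>2)\<close>.\<close>

definition \<rho> :: "'a \<Rightarrow> real" where
  "\<rho> q = E2 v1 q - c123 q * f q + c112 q * v1 q"

lemma rho_mem [simp]: "\<rho> \<in> F"
  unfolding \<rho>_def[abs_def] by simp

lemma E2_v1: "E2 v1 q = \<rho> q + c123 q * f q - c112 q * v1 q"
  by (simp add: \<rho>_def)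

lemma E1_v2: "q \<in> S \<Longrightarrow> E1 v2 q = c212 q * v2 q - c231 q * f q - \<rho> q"
  using shear[of q] by (simp add: \<rho>_def)

text \<open>A symmetry rotates the frame: all derivatives of components of \<open>V\<close> along the frame are now known,
  and the brackets follow by expanding \<open>V\<close> in the frame.\<close>

lemma
  assumes h: "h \<in> F" and q: "q \<in> S"
  shows comm_E1_V: "commutator E1 V h q = - \<rho> q * E2 h q"
    and comm_E2_V: "commutator E2 V h q = \<rho> q * E1 h q"
    and comm_E3_V: "commutator E3 V h q = 0"
proof -
  have *: "commutator D V h q = D v1 q * E1 h q + D v2 q * E2 h q + D f q * E3 h q
    + v1 q * commutator D E1 h q + v2 q * commutator D E2 h q + f q * commutator D E3 h q"
    if "derivation D" for D
    by (rule commutator_combination) (use that h q in \<open>simp_all add: V_def\<close>)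
  note commutators = comm12[OF h q] comm23[OF h q] comm31[OF h q] commutator_swap[of E2 E1 h q]
    commutator_swap[of E3 E2 h q] commutator_swap[of E1 E3 h q] commutator_self c223_eq[OF q] q
  show "commutator E1 V h q = - \<rho> q * E2 h q"
    using *[of E1] by (simp add: commutators E1_v1 E1_v2 E1_f algebra_simps)
  show "commutator E2 V h q = \<rho> q * E1 h q"
    using *[of E2] by (simp add: commutators E2_v1 E2_v2 E2_f algebra_simps)
  show "commutator E3 V h q = 0"
    using *[of E3] by (simp add: commutators E3_v1 E3_v2 E3_f algebra_simps)
qed

text \<open>Comparison of coefficients in the Jacobi identities of \<open>V\<close>, \<open>E\<^sub>i\<close>, \<open>E\<^sub>j\<close>.\<close>

lemma
  assumes q: "q \<in> S"
  shows V_c112: "V c112 q = E1 \<rho> q + \<rho> q * c212 q"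
    and V_c212: "V c212 q = E2 \<rho> q - \<rho> q * c112 q"
    and V_c123: "V c123 q = - E3 \<rho> q + 2 * \<rho> q * c131 q"
    and V_c231: "V c231 q = - E3 \<rho> q - 2 * \<rho> q * c131 q"
    and V_c131: "V c131 q = \<rho> q * (c231 q - c123 q)"
proof -
  have comm_V: "commutator V E1 h q = \<rho> q * E2 h q" "commutator V E2 h q = - \<rho> q * E1 h q"
    "commutator V E3 h q = 0" if "h \<in> F" "q \<in> S" for h q
    using comm_E1_V[OF that] comm_E2_V[OF that] comm_E3_V[OF that]
      commutator_swap[of V _ h q] by auto
  have "(V c112 q - \<rho> q * c212 q - E1 \<rho> q) * E1 h q + (V c212 q + \<rho> q * c112 q - E2 \<rho> q) * E2 h q
      + 0 * E3 h q = 0" if h: "h \<in> F" for h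
  proof -
    have "commutator V (commutator E1 E2) h q = V (\<lambda>q. - c112 q) q * E1 h q
      + V (\<lambda>q. - c212 q) q * E2 h q + V (\<lambda>q. -1) q * E3 h q
      + - c112 q * commutator V E1 h q + - c212 q * commutator V E2 h q + -1 * commutator V E3 h q"
      by (rule commutator_combination) (use h q comm12 in simp_all)
    moreover have "commutator E1 (commutator E2 V) h q = E1 \<rho> q * E1 h q + E1 (\<lambda>q. 0) q * E2 h q
      + E1 (\<lambda>q. 0) q * E3 h q
      + \<rho> q * commutator E1 E1 h q + 0 * commutator E1 E2 h q + 0 * commutator E1 E3 h q"
      by (rule commutator_combination) (use h q comm_E2_V in simp_all)
    moreover have "commutator E2 (commutator V E1) h q = E2 (\<lambda>q. 0) q * E1 h q + E2 \<rho> q * E2 h q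
      + E2 (\<lambda>q. 0) q * E3 h q
      + 0 * commutator E2 E1 h q + \<rho> q * commutator E2 E2 h q + 0 * commutator E2 E3 h q"
      by (rule commutator_combination) (use h q comm_V in simp_all)
    ultimately show ?thesis
      using jacobi[OF derivation_V frame(1,2) h q] comm_V[OF h q] q
      by (simp add: commutator_self algebra_simps)
  qed
  from separating[OF q this] show "V c112 q = E1 \<rho> q + \<rho> q * c212 q"
    "V c212 q = E2 \<rho> q - \<rho> q * c112 q" by auto
  have "(V c123 q - \<rho> q * c223 q + E3 \<rho> q - \<rho> q * c131 q) * E1 h q
      + (V c223 q + \<rho> q * c123 q - \<rho> q * c231 q) * E2 h q + 0 * E3 h q = 0" if h: "h \<in> F" for h
  proof -
    have "commutator V (commutator E2 E3) h q = V (\<lambda>q. - c123 q) q * E1 h q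
      + V (\<lambda>q. - c223 q) q * E2 h q + V (\<lambda>q. 0) q * E3 h q
      + - c123 q * commutator V E1 h q + - c223 q * commutator V E2 h q + 0 * commutator V E3 h q"
      by (rule commutator_combination) (use h q comm23 in simp_all)
    moreover have "commutator E2 (commutator E3 V) h q = E2 (\<lambda>q. 0) q * E1 h q + E2 (\<lambda>q. 0) q * E2 h q
      + E2 (\<lambda>q. 0) q * E3 h q
      + 0 * commutator E2 E1 h q + 0 * commutator E2 E2 h q + 0 * commutator E2 E3 h q"
      by (rule commutator_combination) (use h q comm_E3_V in simp_all)
    moreover have "commutator E3 (commutator V E2) h q = E3 (\<lambda>q. - \<rho> q) q * E1 h q
      + E3 (\<lambda>q. 0) q * E2 h q + E3 (\<lambda>q. 0) q * E3 h q
      + - \<rho> q * commutator E3 E1 h q + 0 * commutator E3 E2 h q + 0 * commutator E3 E3 h q"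
      by (rule commutator_combination) (use h q comm_V in simp_all)
    ultimately show ?thesis
      using jacobi[OF derivation_V frame(2,3) h q] comm_V[OF h q] comm31[OF h q] q
      by (simp add: commutator_self algebra_simps)
  qed
  from separating[OF q this] have "V c123 q - \<rho> q * c223 q + E3 \<rho> q - \<rho> q * c131 q = 0" by blast
  then show "V c123 q = - E3 \<rho> q + 2 * \<rho> q * c131 q" using c223_eq[OF q] by (simp add: algebra_simps)
  have "(V c131 q - \<rho> q * c231 q + \<rho> q * c123 q) * E1 h q
      + (V c231 q + \<rho> q * c131 q + E3 \<rho> q + \<rho> q * c223 q) * E2 h q + 0 * E3 h q = 0" if h: "h \<in> F" for h
  proof -
    have "commutator V (commutator E3 E1) h q = V (\<lambda>q. - c131 q) q * E1 h q
      + V (\<lambda>q. - c231 q) q * E2 h q + V (\<lambda>q. 0) q * E3 h q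
      + - c131 q * commutator V E1 h q + - c231 q * commutator V E2 h q + 0 * commutator V E3 h q"
      by (rule commutator_combination) (use h q comm31 in simp_all)
    moreover have "commutator E1 (commutator V E3) h q = E1 (\<lambda>q. 0) q * E1 h q + E1 (\<lambda>q. 0) q * E2 h q
      + E1 (\<lambda>q. 0) q * E3 h q
      + 0 * commutator E1 E1 h q + 0 * commutator E1 E2 h q + 0 * commutator E1 E3 h q"
      by (rule commutator_combination) (use h q comm_V in simp_all)
    moreover have "commutator E3 (commutator E1 V) h q = E3 (\<lambda>q. 0) q * E1 h q
      + E3 (\<lambda>q. - \<rho> q) q * E2 h q + E3 (\<lambda>q. 0) q * E3 h q
      + 0 * commutator E3 E1 h q + - \<rho> q * commutator E3 E2 h q + 0 * commutator E3 E3 h q"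
      by (rule commutator_combination) (use h q comm_E1_V in simp_all)
    ultimately show ?thesis
      using jacobi[OF derivation_V frame(3,1) h q] comm_V[OF h q] comm23[OF h q]
        commutator_swap[of E3 E2 h q] q
      by (simp add: commutator_self algebra_simps)
  qed
  from separating[OF q this]
  have "V c131 q - \<rho> q * c231 q + \<rho> q * c123 q = 0"
    "V c231 q + \<rho> q * c131 q + E3 \<rho> q + \<rho> q * c223 q = 0" by auto
  then show "V c131 q = \<rho> q * (c231 q - c123 q)" "V c231 q = - E3 \<rho> q - 2 * \<rho> q * c131 q"
    using c223_eq[OF q] by (simp_all add: algebra_simps)
qed

text \<open>The derivatives of \<open>(c123 - c231) / 2\<close> and \<open>c131\<close> along \<open>V\<close> are \<open>2\<rho> c131\<close> and
  \<open>- 2\<rho> (c123 - c231) / 2\<close>: an infinitesimal rotation of the plane.\<close>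

lemma V_invariant_M:
  assumes q: "q \<in> S"
  shows "V (\<lambda>q. ((c123 q - c231 q) / 2)\<^sup>2 + (c131 q)\<^sup>2) q = 0"
proof -
  \<comment> \<open>a named constant keeps the product in the form to which the Leibniz rule applies\<close>
  define k :: real where "k = 1 / 4"
  have "(\<lambda>q. ((c123 q - c231 q) / 2)\<^sup>2 + (c131 q)\<^sup>2)
      = (\<lambda>q. k * ((c123 q - c231 q) * (c123 q - c231 q)) + c131 q * c131 q)"
    by (simp add: fun_eq_iff power2_eq_square k_def)
  moreover have "V (\<lambda>q. k * ((c123 q - c231 q) * (c123 q - c231 q)) + c131 q * c131 q) q
      = (2 - 8 * k) * (\<rho> q * c131 q * (c231 q - c123 q))"
    by (simp add: q V_c123 V_c231 V_c131) (simp add: algebra_simps)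
  ultimately show ?thesis by (simp add: k_def)
qed

text \<open>The second derivatives of \<open>\<rho>\<close> in \<open>V(E\<^sub>1c212 - E\<^sub>2c112)\<close> form the commutator \<open>[E\<^sub>1, E\<^sub>2]\<rho>\<close>, whose first
  derivatives of \<open>\<rho>\<close> along \<open>E\<^sub>1\<close> and \<open>E\<^sub>2\<close> are cancelled by the squares, together with those from
  the product rule, and whose derivative along \<open>E\<^sub>3\<close> is cancelled by the last term.\<close>

lemma V_invariant_K:
  assumes q: "q \<in> S"
  shows "V (\<lambda>q. E1 c212 q - E2 c112 q + (c112 q)\<^sup>2 + (c212 q)\<^sup>2 - 1/2 * (c123 q + c231 q)) q = 0"
proof -
  have "V (E1 c212) q = E1 (V c212) q + \<rho> q * E2 c212 q"
    using comm_E1_V[OF coeffs(6) q] by (simp add: commutator_def)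
  also have "E1 (V c212) q = E1 (\<lambda>q. E2 \<rho> q - \<rho> q * c112 q) q"
    by (rule derivation_cong) (simp_all add: q V_c212)
  finally have 1: "V (E1 c212) q = E1 (E2 \<rho>) q - \<rho> q * E1 c112 q - E1 \<rho> q * c112 q + \<rho> q * E2 c212 q"
    by (simp add: q)
  have "V (E2 c112) q = E2 (V c112) q - \<rho> q * E1 c112 q"
    using comm_E2_V[OF coeffs(3) q] by (simp add: commutator_def)
  also have "E2 (V c112) q = E2 (\<lambda>q. E1 \<rho> q + \<rho> q * c212 q) q"
    by (rule derivation_cong) (simp_all add: q V_c112)
  finally have 2: "V (E2 c112) q = E2 (E1 \<rho>) q + \<rho> q * E2 c212 q + E2 \<rho> q * c212 q - \<rho> q * E1 c112 q"
    by (simp add: q)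
  have 3: "E1 (E2 \<rho>) q - E2 (E1 \<rho>) q = - c112 q * E1 \<rho> q - c212 q * E2 \<rho> q - E3 \<rho> q"
    using comm12[OF rho_mem q] by (simp add: commutator_def)
  define k :: real where "k = 1 / 2"
  have "V (\<lambda>q. E1 c212 q - E2 c112 q + (c112 q)\<^sup>2 + (c212 q)\<^sup>2 - k * (c123 q + c231 q)) q
      = (2 * k - 1) * E3 \<rho> q"
    unfolding power2_eq_square using 3
    by (simp add: q 1 2 V_c112 V_c212 V_c123 V_c231) (simp add: algebra_simps)
  then show ?thesis by (simp add: k_def)
qed

end

section \<open>Coframes on a manifold\<close>

locale framed_manifold3 = manifold3 A
  for A :: "'a::{t2_space, second_countable_topology} chart set" +
  fixes U :: "'a set" and \<eta>1 \<eta>2 \<eta>3 :: "'a form1" and E1 E2 E3 :: "'a vfield"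
    and c123 c131 c112 c223 c231 c212 :: "'a \<Rightarrow> real"
  assumes open_U: "open U"
    and smooth_\<eta>: "smooth_form1 A U \<eta>1" "smooth_form1 A U \<eta>2" "smooth_form1 A U \<eta>3"
    and dual_frame: "dual_frame_field A U \<eta>1 \<eta>2 \<eta>3 E1 E2 E3"
    and smooth_coeffs: "smooth_fun A U c123" "smooth_fun A U c131" "smooth_fun A U c112"
      "smooth_fun A U c223" "smooth_fun A U c231" "smooth_fun A U c212"
    and d_\<eta>1: "q \<in> U \<Longrightarrow> ext_deriv A \<eta>1 q u v = c123 q * (\<eta>2 \<and>\<^sub>1 \<eta>3) q u v
      + c131 q * (\<eta>3 \<and>\<^sub>1 \<eta>1) q u v + c112 q * (\<eta>1 \<and>\<^sub>1 \<eta>2) q u v"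
    and d_\<eta>2: "q \<in> U \<Longrightarrow> ext_deriv A \<eta>2 q u v = c223 q * (\<eta>2 \<and>\<^sub>1 \<eta>3) q u v
      + c231 q * (\<eta>3 \<and>\<^sub>1 \<eta>1) q u v + c212 q * (\<eta>1 \<and>\<^sub>1 \<eta>2) q u v"
    and d_\<eta>3: "q \<in> U \<Longrightarrow> ext_deriv A \<eta>3 q u v = (\<eta>1 \<and>\<^sub>1 \<eta>2) q u v"
begin

lemma smooth_frame: "smooth_vfield A U E1" "smooth_vfield A U E2" "smooth_vfield A U E3"
  using dual_frame by (auto simp: dual_frame_field_def)

lemma dual [simp]:
  assumes "q \<in> U"
  shows "\<eta>1 q (E1 q) = 1" "\<eta>1 q (E2 q) = 0" "\<eta>1 q (E3 q) = 0"
    "\<eta>2 q (E1 q) = 0" "\<eta>2 q (E2 q) = 1" "\<eta>2 q (E3 q) = 0"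
    "\<eta>3 q (E1 q) = 0" "\<eta>3 q (E2 q) = 0" "\<eta>3 q (E3 q) = 1"
  using dual_frame assms by (auto simp: dual_frame_field_def)

lemma linear_\<eta>:
  assumes "q \<in> U"
  shows "linear (\<eta>1 q)" "linear (\<eta>2 q)" "linear (\<eta>3 q)"
  using smooth_\<eta> assms by (auto simp: smooth_form1_def)

lemma \<eta>_linear_rules:
  assumes "q \<in> U"
  shows "\<eta>1 q (u + v) = \<eta>1 q u + \<eta>1 q v" "\<eta>1 q (k *\<^sub>R u) = k * \<eta>1 q u" "\<eta>1 q (u - v) = \<eta>1 q u - \<eta>1 q v"
    "\<eta>2 q (u + v) = \<eta>2 q u + \<eta>2 q v" "\<eta>2 q (k *\<^sub>R u) = k * \<eta>2 q u" "\<eta>2 q (u - v) = \<eta>2 q u - \<eta>2 q v"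
    "\<eta>3 q (u + v) = \<eta>3 q u + \<eta>3 q v" "\<eta>3 q (k *\<^sub>R u) = k * \<eta>3 q u" "\<eta>3 q (u - v) = \<eta>3 q u - \<eta>3 q v"
  using linear_\<eta>[OF assms] by (simp_all add: linear_add linear_scale linear_diff)

text \<open>The map \<open>(\<eta>\<^sup>1, \<eta>\<^sup>2, \<eta>\<^sup>3)\<close> is onto because of the dual frame, hence injective for reasons of
  dimension.\<close>

lemma coframe_ext:
  assumes q: "q \<in> U" and eq: "\<eta>1 q u = \<eta>1 q v" "\<eta>2 q u = \<eta>2 q v" "\<eta>3 q u = \<eta>3 q v"
  shows "u = v"
proof -
  define T :: "real^3 \<Rightarrow> real^3" where "T w = vector [\<eta>1 q w, \<eta>2 q w, \<eta>3 q w]" for w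
  have "linear T"
    by (rule linearI) (simp_all add: T_def vec_eq_iff forall_3 \<eta>_linear_rules[OF q])
  moreover have "surj T"
  proof (rule surjI)
    show "T (y $ 1 *\<^sub>R E1 q + y $ 2 *\<^sub>R E2 q + y $ 3 *\<^sub>R E3 q) = y" for y
      using q by (simp add: T_def vec_eq_iff forall_3 \<eta>_linear_rules[OF q])
  qed
  ultimately have "inj T" by (simp add: linear_surjective_imp_injective)
  then show ?thesis by (rule injD) (simp add: T_def eq)
qed

lemma frame_expansion:
  assumes q: "q \<in> U"
  shows "w = \<eta>1 q w *\<^sub>R E1 q + \<eta>2 q w *\<^sub>R E2 q + \<eta>3 q w *\<^sub>R E3 q"
  using q by (intro coframe_ext[OF q]) (simp_all add: \<eta>_linear_rules)

lemma vderiv_expansion: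
  assumes q: "q \<in> U" "q \<in> W" and h: "smooth_fun A W h"
  shows "vderiv A X h q = \<eta>1 q (X q) * vderiv A E1 h q + \<eta>2 q (X q) * vderiv A E2 h q
    + \<eta>3 q (X q) * vderiv A E3 h q"
proof -
  note lin = linear_vderiv[OF h q(2)]
  have "vderiv A X h q = vderiv A (\<lambda>_. X q) h q" by (rule vderiv_const_field[symmetric])
  also have "\<dots> = vderiv A (\<lambda>_. \<eta>1 q (X q) *\<^sub>R E1 q + \<eta>2 q (X q) *\<^sub>R E2 q + \<eta>3 q (X q) *\<^sub>R E3 q) h q"
    using frame_expansion[OF q(1), of "X q"] by simp
  also have "\<dots> = \<eta>1 q (X q) * vderiv A (\<lambda>_. E1 q) h q + \<eta>2 q (X q) * vderiv A (\<lambda>_. E2 q) h q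
    + \<eta>3 q (X q) * vderiv A (\<lambda>_. E3 q) h q"
    using linear_add[OF lin] linear_scale[OF lin] by simp
  finally show ?thesis by (simp add: vderiv_const_field)
qed

text \<open>The two derivatives in Cartan's formula vanish for a form that is constant on both fields, such
  as \<open>\<eta>\<^sup>i\<close> on the frame.\<close>

lemma form_lie_bracket:
  assumes q: "q \<in> U" and \<alpha>: "smooth_form1 A U \<alpha>"
    and X: "smooth_vfield A U X" and Y: "smooth_vfield A U Y"
    and c: "\<And>q. q \<in> U \<Longrightarrow> \<alpha> q (X q) = a" "\<And>q. q \<in> U \<Longrightarrow> \<alpha> q (Y q) = b"
  shows "\<alpha> q (lie_bracket X Y q) = - ext_deriv A \<alpha> q (X q) (Y q)"
  using ext_deriv_lie_bracket[OF open_U q \<alpha> X Y]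
    vderiv_cong[OF open_U q, of "\<lambda>q. \<alpha> q (X q)" "\<lambda>_. a" Y] c(1)
    vderiv_cong[OF open_U q, of "\<lambda>q. \<alpha> q (Y q)" "\<lambda>_. b" X] c(2)
  by (simp add: vderiv_const)

lemma frame_commutator:
  assumes W: "open W" "W \<subseteq> U" "q \<in> W" and h: "smooth_fun A W h"
  shows "vderiv A E2 (vderiv A E3 h) q - vderiv A E3 (vderiv A E2 h) q
      = - c123 q * vderiv A E1 h q - c223 q * vderiv A E2 h q" (is ?A)
    and "vderiv A E3 (vderiv A E1 h) q - vderiv A E1 (vderiv A E3 h) q
      = - c131 q * vderiv A E1 h q - c231 q * vderiv A E2 h q" (is ?B)
    and "vderiv A E1 (vderiv A E2 h) q - vderiv A E2 (vderiv A E1 h) q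
      = - c112 q * vderiv A E1 h q - c212 q * vderiv A E2 h q - vderiv A E3 h q" (is ?C)
proof -
  have q: "q \<in> U" using W by auto
  have comm: "vderiv A X (vderiv A Y h) q - vderiv A Y (vderiv A X h) q
    = \<eta>1 q (lie_bracket X Y q) * vderiv A E1 h q + \<eta>2 q (lie_bracket X Y q) * vderiv A E2 h q
    + \<eta>3 q (lie_bracket X Y q) * vderiv A E3 h q"
    if "smooth_vfield A U X" "smooth_vfield A U Y" for X Y
    using vderiv_commutator[OF W(1,3) h smooth_vfield_subset[OF that(1) W(2)]
        smooth_vfield_subset[OF that(2) W(2)]] vderiv_expansion[OF q W(3) h, of "lie_bracket X Y"]
    by simp
  note fl1 = form_lie_bracket[OF q smooth_\<eta>(1)] and fl2 = form_lie_bracket[OF q smooth_\<eta>(2)]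
    and fl3 = form_lie_bracket[OF q smooth_\<eta>(3)]
  note d = d_\<eta>1 d_\<eta>2 d_\<eta>3 wedge_def q
  show ?A
    unfolding comm[OF smooth_frame(2,3)]
    using fl1[OF smooth_frame(2,3) dual(2,3)] fl2[OF smooth_frame(2,3) dual(5,6)]
      fl3[OF smooth_frame(2,3) dual(8,9)] by (simp add: d)
  show ?B
    unfolding comm[OF smooth_frame(3,1)]
    using fl1[OF smooth_frame(3,1) dual(3,1)] fl2[OF smooth_frame(3,1) dual(6,4)]
      fl3[OF smooth_frame(3,1) dual(9,7)] by (simp add: d)
  show ?C
    unfolding comm[OF smooth_frame(1,2)]
    using fl1[OF smooth_frame(1,2) dual(1,2)] fl2[OF smooth_frame(1,2) dual(4,5)]
      fl3[OF smooth_frame(1,2) dual(7,8)] by (simp add: d)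
qed

text \<open>The coordinate functions of a chart separate tangent vectors.  They are defined on the chart
  domain only, so the algebraic results are applied on \<open>U \<inter> dom_chart c\<close> instead of \<open>U\<close>.\<close>

lemma frame_separating:
  assumes c: "c \<in> A" and q: "q \<in> U" "q \<in> dom_chart c"
    and zero: "\<And>h. smooth_fun A (U \<inter> dom_chart c) h \<Longrightarrow>
      k1 * vderiv A E1 h q + k2 * vderiv A E2 h q + k3 * vderiv A E3 h q = 0"
  shows "k1 = 0 \<and> k2 = 0 \<and> k3 = 0"
proof -
  define w where "w = k1 *\<^sub>R E1 q + k2 *\<^sub>R E2 q + k3 *\<^sub>R E3 q"
  have "tchange (pchart A q) c q w $ i = 0" for i
  proof -
    let ?h = "\<lambda>q. coord c q $ i"
    have h: "smooth_fun A (U \<inter> dom_chart c) ?h"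
      unfolding smooth_fun_def
    proof
      fix b assume b: "b \<in> A"
      have "smooth_on (coord c \<circ> inv_chart b) (coord b ` (dom_chart b \<inter> dom_chart c))"
        using manifold b c by (auto simp: oriented_manifold3_def)
      then have "smooth_on (coord c \<circ> inv_chart b) (coord b ` (U \<inter> dom_chart c \<inter> dom_chart b))"
        by (rule smooth_on_subset) auto
      with smooth_on_nth[OF open_coord_image[OF b open_Int[OF open_U open_dom[OF c]]] this, of i]
      show "smooth_on (?h \<circ> inv_chart b) (coord b ` (U \<inter> dom_chart c \<inter> dom_chart b))"
        by (simp add: o_def)
    qed
    have lin: "linear (\<lambda>w. vderiv A (\<lambda>_. w) ?h q)"
      by (rule linear_vderiv[OF h]) (use q in auto)
    have "((\<lambda>x. x $ i) has_derivative (\<lambda>w. w $ i)) (at (coord c q))"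
      by (rule bounded_linear_imp_has_derivative[OF bounded_linear_vec_nth])
    then have "(?h \<circ> inv_chart c has_derivative (\<lambda>w. w $ i)) (at (coord c q))"
      by (rule has_derivative_transform_within_open[OF _ open_coord_image[OF c open_UNIV]])
        (use q coord_inv_chart[OF c] in auto)
    from vderiv_in_chart[OF c q(2) this, of "\<lambda>_. w"]
    have "tchange (pchart A q) c q w $ i = vderiv A (\<lambda>_. w) ?h q" by simp
    also have "\<dots> = k1 * vderiv A (\<lambda>_. E1 q) ?h q + k2 * vderiv A (\<lambda>_. E2 q) ?h q
        + k3 * vderiv A (\<lambda>_. E3 q) ?h q"
      unfolding w_def using linear_add[OF lin] linear_scale[OF lin] by simp
    finally show ?thesis using zero[OF h] by (simp add: vderiv_const_field)
  qed
  then have "tchange (pchart A q) c q w = 0" by (simp add: vec_eq_iff)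
  moreover have "tchange c (pchart A q) q 0 = 0"
    by (rule linear_0[OF linear_tchange]) (use c q pchart in auto)
  ultimately have "w = 0" using tchange_inverse[OF pchart c q(2), of w] by simp
  then have "\<eta>1 q w = 0" "\<eta>2 q w = 0" "\<eta>3 q w = 0"
    using linear_\<eta>[OF q(1)] by (simp_all add: linear_0)
  then show ?thesis using q(1) by (simp add: w_def \<eta>_linear_rules)
qed

lemma contact_frame_chart:
  assumes c: "c \<in> A"
  defines "W \<equiv> U \<inter> dom_chart c"
  shows "contact_frame {h. smooth_fun A W h} W (vderiv A E1) (vderiv A E2) (vderiv A E3)
    c123 c131 c112 c223 c231 c212"
proof -
  have W: "open W" "W \<subseteq> U" unfolding W_def using open_U open_dom[OF c] by auto
  interpret function_algebra "{h. smooth_fun A W h}" W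
    by unfold_locales
      (simp_all add: smooth_fun_const smooth_fun_add[OF W(1)] smooth_fun_mult[OF W(1)])
  have der: "derivation (vderiv A X)" if "smooth_vfield A U X" for X
    unfolding derivation_def
  proof (intro conjI ballI allI impI)
    show "vderiv A X h \<in> {h. smooth_fun A W h}" if "h \<in> {h. smooth_fun A W h}" for h
      using smooth_fun_vderiv[OF W(1) _ smooth_vfield_subset[OF \<open>smooth_vfield A U X\<close> W(2)]] that by simp
    show "vderiv A X f q = vderiv A X h q" if "\<forall>q\<in>W. f q = h q" "q \<in> W" for f h q
      using vderiv_cong[OF W(1) that(2)] that(1) by blast
  qed (simp_all add: vderiv_const vderiv_add[of W] vderiv_mult[of W])
  show ?thesis
  proof unfold_locales
    show "k1 = 0 \<and> k2 = 0 \<and> k3 = 0" if "q \<in> W"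
      and "\<And>h. h \<in> {h. smooth_fun A W h} \<Longrightarrow>
        k1 * vderiv A E1 h q + k2 * vderiv A E2 h q + k3 * vderiv A E3 h q = 0" for q k1 k2 k3
      by (rule frame_separating[OF c, of q]) (use that in \<open>auto simp: W_def\<close>)
  qed (use der smooth_frame smooth_coeffs smooth_fun_subset[OF _ W(2)] in
      \<open>auto simp: commutator_def frame_commutator[OF W]\<close>)
qed

end

section \<open>Infinitesimal symmetries of a framed contact sub-Riemannian surface\<close>

locale framed_symmetry = framed_manifold3 A U \<eta>1 \<eta>2 \<eta>3 E1 E2 E3 c123 c131 c112 c223 c231 c212
  for A :: "'a::{t2_space, second_countable_topology} chart set" and U \<eta>1 \<eta>2 \<eta>3 E1 E2 E3
    c123 c131 c112 c223 c231 c212 +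
  fixes \<Delta> :: "'a \<Rightarrow> (real^3) set" and ori :: "'a \<Rightarrow> ((real^3) \<times> (real^3)) set"
    and g :: "'a \<Rightarrow> real^3 \<Rightarrow> real^3 \<Rightarrow> real" and V :: "'a vfield"
  assumes distribution: "oriented_distribution2 A \<Delta> ori"
    and adapted: "adapted_coframe_field A \<Delta> ori g U \<eta>1 \<eta>2 \<eta>3"
    and symmetric: "infinitesimal_symmetry A \<Delta> g V"
begin

text \<open>A local oriented basis of \<open>\<Delta>\<close> has a nonzero determinant with respect to \<open>(\<eta>\<^sup>1, \<eta>\<^sup>2)\<close>, so it spans
  the whole kernel of \<open>\<eta>\<^sup>3\<close>.  In particular \<open>E\<^sub>1\<close> and \<open>E\<^sub>2\<close> lie in \<open>\<Delta>\<close>.\<close>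

lemma \<Delta>_eq_kernel:
  assumes q: "q \<in> U"
  shows "\<Delta> q = {w. \<eta>3 q w = 0}"
proof
  have ad: "adapted_coframe \<Delta> ori g q (\<eta>1 q) (\<eta>2 q) (\<eta>3 q)"
    using adapted q by (simp add: adapted_coframe_field_def)
  have ker: "\<forall>w\<in>\<Delta> q. \<eta>3 q w = 0"
    and orient: "\<forall>(u, v) \<in> ori q. \<eta>1 q u * \<eta>2 q v - \<eta>1 q v * \<eta>2 q u > 0"
    using ad unfolding adapted_coframe_def by simp_all
  show "\<Delta> q \<subseteq> {w. \<eta>3 q w = 0}" using ker by blast
  obtain X Y where XY: "\<Delta> q = span {X, Y}"
    "ori q = {(a *\<^sub>R X + b *\<^sub>R Y, c *\<^sub>R X + d *\<^sub>R Y) | a b c d. a * d - b * c > 0}"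
  proof -
    from spec[OF distribution[unfolded oriented_distribution2_def], of q]
    obtain W X' Y' where "q \<in> W" and *: "\<forall>q\<in>W. X' q \<noteq> Y' q \<and> independent {X' q, Y' q} \<and>
      \<Delta> q = span {X' q, Y' q} \<and>
      ori q = {(a *\<^sub>R X' q + b *\<^sub>R Y' q, c *\<^sub>R X' q + d *\<^sub>R Y' q) | a b c d. a * d - b * c > 0}"
      by (elim exE conjE) (rule that)
    from bspec[OF this(2) this(1)] show thesis by (elim conjE) (rule that)
  qed
  have "(X, Y) \<in> ori q"
    unfolding XY(2)
    by (rule CollectI, rule exI[of _ 1], rule exI[of _ 0], rule exI[of _ 0], rule exI[of _ 1]) simp
  then have "\<eta>1 q X * \<eta>2 q Y - \<eta>1 q Y * \<eta>2 q X > 0"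
    using orient by blast
  then obtain D where D: "D \<noteq> 0" "D = \<eta>1 q X * \<eta>2 q Y - \<eta>1 q Y * \<eta>2 q X" by auto
  have XY\<Delta>: "X \<in> \<Delta> q" "Y \<in> \<Delta> q" unfolding XY(1) by (auto intro: span_base)
  have 3: "\<eta>3 q X = 0" "\<eta>3 q Y = 0" using ker XY\<Delta> by auto
  show "{w. \<eta>3 q w = 0} \<subseteq> \<Delta> q"
  proof
    fix w assume w: "w \<in> {w. \<eta>3 q w = 0}"
    \<comment> \<open>Cramer's rule for the two conditions on \<open>\<eta>\<^sup>1\<close> and \<open>\<eta>\<^sup>2\<close>\<close>
    define a where "a = (\<eta>1 q w * \<eta>2 q Y - \<eta>1 q Y * \<eta>2 q w) / D"
    define b where "b = (\<eta>1 q X * \<eta>2 q w - \<eta>1 q w * \<eta>2 q X) / D"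
    have "w = a *\<^sub>R X + b *\<^sub>R Y"
    proof (rule coframe_ext[OF q])
      have "D * \<eta>1 q w = D * (a * \<eta>1 q X + b * \<eta>1 q Y)"
        using D(1) by (simp add: a_def b_def distrib_left) (simp add: D(2) algebra_simps)
      then show "\<eta>1 q w = \<eta>1 q (a *\<^sub>R X + b *\<^sub>R Y)"
        using D(1) by (simp add: \<eta>_linear_rules[OF q])
      have "D * \<eta>2 q w = D * (a * \<eta>2 q X + b * \<eta>2 q Y)"
        using D(1) by (simp add: a_def b_def distrib_left) (simp add: D(2) algebra_simps)
      then show "\<eta>2 q w = \<eta>2 q (a *\<^sub>R X + b *\<^sub>R Y)"
        using D(1) by (simp add: \<eta>_linear_rules[OF q])
      show "\<eta>3 q w = \<eta>3 q (a *\<^sub>R X + b *\<^sub>R Y)"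
        using w 3 by (simp add: \<eta>_linear_rules[OF q])
    qed
    then show "w \<in> \<Delta> q"
      unfolding XY(1) by (metis span_add span_scale span_base insertI1 insertI2)
  qed
qed

lemma metric_coframe:
  "q \<in> U \<Longrightarrow> w \<in> \<Delta> q \<Longrightarrow> g q w w = (\<eta>1 q w)\<^sup>2 + (\<eta>2 q w)\<^sup>2"
  using adapted by (simp add: adapted_coframe_field_def adapted_coframe_def)

lemma smooth_V: "smooth_vfield A UNIV V"
  using symmetric by (simp add: infinitesimal_symmetry_def)

lemma smooth_V_U: "smooth_vfield A U V"
  using smooth_vfield_subset[OF smooth_V] by blast

text \<open>Cartan's formula for \<open>(L\<^sub>V\<alpha>)(w)\<close>.\<close>

definition lie_derivative :: "'a form1 \<Rightarrow> 'a \<Rightarrow> real^3 \<Rightarrow> real" where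
  "lie_derivative \<alpha> q w = ext_deriv A \<alpha> q (V q) w + vderiv A (\<lambda>_. w) (\<lambda>q. \<alpha> q (V q)) q"

text \<open>For \<open>w\<close> in \<open>\<Delta>\<close>, the values of \<open>\<eta>\<^sup>3\<close> and \<open>(\<eta>\<^sup>1)\<^sup>2 + (\<eta>\<^sup>2)\<^sup>2\<close> on the vector transported by the flow
  are constant in time, since the flow consists of symmetries.\<close>

lemma lie_derivative_conditions:
  assumes q: "q \<in> U" and w: "w \<in> \<Delta> q"
  shows "lie_derivative \<eta>3 q w = 0"
    and "\<eta>1 q w * lie_derivative \<eta>1 q w + \<eta>2 q w * lie_derivative \<eta>2 q w = 0"
proof -
  obtain \<epsilon> W \<Phi> where W: "q \<in> W" and flow: "local_flow A V \<epsilon> W \<Phi>"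
    and sym: "\<And>t. t \<in> {-\<epsilon><..<\<epsilon>} \<Longrightarrow> symmetry A \<Delta> g W (\<Phi> t)"
    using symmetric unfolding infinitesimal_symmetry_def by meson
  \<comment> \<open>the flow line may leave \<open>U\<close>, where the coframe says nothing\<close>
  define T where "T = {t \<in> {-\<epsilon><..<\<epsilon>}. \<Phi> t q \<in> U}"
  have T: "open T" "0 \<in> T"
    using open_flow_times[OF flow W open_U] flow_pos[OF flow] flow_zero[OF flow W] q
    by (auto simp: T_def)
  let ?w = "\<lambda>t. tangent_map A (\<Phi> t) q w"
  have w0: "?w 0 = w"
  proof -
    have "((\<lambda>x. x) has_derivative (\<lambda>w. w)) (at (coord (pchart A q) q))"
      by (rule has_derivative_ident)
    then have "((coord (pchart A q) \<circ> \<Phi> 0 \<circ> inv_chart (pchart A q)) has_derivative (\<lambda>w. w))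
        (at (coord (pchart A q) q))"
      by (rule has_derivative_transform_within_open[OF _ open_coord_image[OF pchart(1) flow_open[OF flow]]
            coord_pchart_in[OF W]])
        (auto simp: inv_chart_coord[OF pchart(1)] flow_zero[OF flow])
    from frechet_derivative_eqI[OF this] show ?thesis
      by (simp add: tangent_map_def Let_def flow_zero[OF flow W])
  qed
  have tangent: "?w t \<in> \<Delta> (\<Phi> t q)" "g (\<Phi> t q) (?w t) (?w t) = g q w w" if "t \<in> T" for t
    using sym[of t] that W w unfolding symmetry_def T_def by blast+
  have D: "((\<lambda>t. \<alpha> (\<Phi> t q) (?w t)) has_real_derivative lie_derivative \<alpha> q w) (at 0)"
    if "smooth_form1 A U \<alpha>" for \<alpha>
    unfolding lie_derivative_def
    by (rule has_real_derivative_form_flow[OF flow open_U q W that smooth_V_U])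
  have derivative_const: "d = 0"
    if "(k has_real_derivative d) (at 0)" "\<And>t. t \<in> T \<Longrightarrow> k t = r" for k d r
  proof -
    have "((\<lambda>_. r) has_real_derivative d) (at 0)"
      using that(1) by (rule has_field_derivative_transform_within_open[OF _ T]) (rule that(2))
    then show ?thesis using DERIV_unique DERIV_const by blast
  qed
  show "lie_derivative \<eta>3 q w = 0"
    by (rule derivative_const[OF D[OF smooth_\<eta>(3)]]) (use tangent(1) \<Delta>_eq_kernel T_def in auto)
  have "2 * (\<eta>1 q w * lie_derivative \<eta>1 q w + \<eta>2 q w * lie_derivative \<eta>2 q w) = 0"
  proof (rule derivative_const)
    have "\<Phi> 0 q = q" by (rule flow_zero[OF flow W])
    then show "((\<lambda>t. (\<eta>1 (\<Phi> t q) (?w t))\<^sup>2 + (\<eta>2 (\<Phi> t q) (?w t))\<^sup>2) has_real_derivative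
        2 * (\<eta>1 q w * lie_derivative \<eta>1 q w + \<eta>2 q w * lie_derivative \<eta>2 q w)) (at 0)"
      using w0 by (auto intro!: derivative_eq_intros D smooth_\<eta> simp: algebra_simps)
    show "(\<eta>1 (\<Phi> t q) (?w t))\<^sup>2 + (\<eta>2 (\<Phi> t q) (?w t))\<^sup>2 = g q w w" if "t \<in> T" for t
      using tangent[OF that] metric_coframe[of "\<Phi> t q" "?w t"] that by (simp add: T_def)
  qed
  then show "\<eta>1 q w * lie_derivative \<eta>1 q w + \<eta>2 q w * lie_derivative \<eta>2 q w = 0" by simp
qed

definition v1 :: "'a \<Rightarrow> real" where "v1 q = \<eta>1 q (V q)"
definition v2 :: "'a \<Rightarrow> real" where "v2 q = \<eta>2 q (V q)"
definition f :: "'a \<Rightarrow> real" where "f q = \<eta>3 q (V q)"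

lemma smooth_components: "smooth_fun A U v1" "smooth_fun A U v2" "smooth_fun A U f"
  unfolding v1_def[abs_def] v2_def[abs_def] f_def[abs_def]
  by (intro smooth_fun_form_vfield[OF open_U] smooth_\<eta> smooth_V_U)+

lemma lie_derivative_components:
  assumes q: "q \<in> U"
  shows "lie_derivative \<eta>1 q w = c123 q * (v2 q * \<eta>3 q w - \<eta>2 q w * f q)
      + c131 q * (f q * \<eta>1 q w - \<eta>3 q w * v1 q) + c112 q * (v1 q * \<eta>2 q w - \<eta>1 q w * v2 q)
      + vderiv A (\<lambda>_. w) v1 q"
    and "lie_derivative \<eta>2 q w = c223 q * (v2 q * \<eta>3 q w - \<eta>2 q w * f q)
      + c231 q * (f q * \<eta>1 q w - \<eta>3 q w * v1 q) + c212 q * (v1 q * \<eta>2 q w - \<eta>1 q w * v2 q)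
      + vderiv A (\<lambda>_. w) v2 q"
    and "lie_derivative \<eta>3 q w = v1 q * \<eta>2 q w - \<eta>1 q w * v2 q + vderiv A (\<lambda>_. w) f q"
  using q unfolding v1_def[abs_def] v2_def[abs_def] f_def[abs_def]
  by (simp_all add: lie_derivative_def d_\<eta>1 d_\<eta>2 d_\<eta>3 wedge_def mult.commute)

text \<open>The values \<open>w = E\<^sub>1, E\<^sub>2, E\<^sub>1 + E\<^sub>2\<close> exhaust the quadratic condition on \<open>\<Delta>\<close> by polarisation.\<close>

lemma symmetry_equations:
  assumes q: "q \<in> U"
  shows "vderiv A E1 f q = v2 q" and "vderiv A E2 f q = - v1 q"
    and "vderiv A E1 v1 q = c112 q * v2 q - c131 q * f q"
    and "vderiv A E2 v2 q = c223 q * f q - c212 q * v1 q"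
    and "(vderiv A E2 v1 q - c123 q * f q + c112 q * v1 q)
      + (vderiv A E1 v2 q + c231 q * f q - c212 q * v2 q) = 0"
proof -
  have \<Delta>: "E1 q \<in> \<Delta> q" "E2 q \<in> \<Delta> q" "E1 q + E2 q \<in> \<Delta> q"
    using q by (simp_all add: \<Delta>_eq_kernel \<eta>_linear_rules)
  have add: "vderiv A (\<lambda>_. E1 q + E2 q) h q = vderiv A E1 h q + vderiv A E2 h q"
    if "smooth_fun A U h" for h
    using linear_add[OF linear_vderiv[OF that q], of "E1 q" "E2 q"] by (simp add: vderiv_const_field)
  note L = lie_derivative_components[OF q] vderiv_const_field
  show "vderiv A E1 f q = v2 q" "vderiv A E2 f q = - v1 q"
    using lie_derivative_conditions(1)[OF q \<Delta>(1)] lie_derivative_conditions(1)[OF q \<Delta>(2)] q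
    by (simp_all add: L)
  show 11: "vderiv A E1 v1 q = c112 q * v2 q - c131 q * f q"
    using lie_derivative_conditions(2)[OF q \<Delta>(1)] q by (simp add: L)
  show 22: "vderiv A E2 v2 q = c223 q * f q - c212 q * v1 q"
    using lie_derivative_conditions(2)[OF q \<Delta>(2)] q by (simp add: L)
  show "(vderiv A E2 v1 q - c123 q * f q + c112 q * v1 q)
      + (vderiv A E1 v2 q + c231 q * f q - c212 q * v2 q) = 0"
    using lie_derivative_conditions(2)[OF q \<Delta>(3)] q 11 22
    by (simp add: L add smooth_components \<eta>_linear_rules algebra_simps)
qed

lemma V_expansion:
  assumes q: "q \<in> U"
  shows "V q = - vderiv A E2 f q *\<^sub>R E1 q + vderiv A E1 f q *\<^sub>R E2 q + f q *\<^sub>R E3 q"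
  using frame_expansion[OF q, of "V q"] symmetry_equations(1,2)[OF q]
  by (simp add: v1_def v2_def f_def)

lemma contact_symmetry_chart:
  assumes c: "c \<in> A"
  defines "W \<equiv> U \<inter> dom_chart c"
  shows "contact_symmetry {h. smooth_fun A W h} W (vderiv A E1) (vderiv A E2) (vderiv A E3)
    c123 c131 c112 c223 c231 c212 v1 v2 f"
proof -
  interpret contact_frame "{h. smooth_fun A W h}" W "vderiv A E1" "vderiv A E2" "vderiv A E3"
    c123 c131 c112 c223 c231 c212
    unfolding W_def by (rule contact_frame_chart[OF c])
  have "W \<subseteq> U" by (simp add: W_def)
  then show ?thesis
    by unfold_locales (use smooth_components symmetry_equations in \<open>auto intro: smooth_fun_subset\<close>)
qed

lemma E3_f: "q \<in> U \<Longrightarrow> vderiv A E3 f q = 0"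
  using contact_symmetry.E3_f[OF contact_symmetry_chart[OF pchart(1)], of q] pchart(2) by blast

lemma
  assumes q: "q \<in> U"
  shows V_M: "M = (\<lambda>q. ((c123 q - c231 q) / 2)\<^sup>2 + (c131 q)\<^sup>2) \<Longrightarrow>
      - vderiv A E2 f q * vderiv A E1 M q + vderiv A E1 f q * vderiv A E2 M q + f q * vderiv A E3 M q = 0"
    and V_K: "K = (\<lambda>q. vderiv A E1 c212 q - vderiv A E2 c112 q + (c112 q)\<^sup>2 + (c212 q)\<^sup>2
                   - 1/2 * (c123 q + c231 q)) \<Longrightarrow>
      - vderiv A E2 f q * vderiv A E1 K q + vderiv A E1 f q * vderiv A E2 K q + f q * vderiv A E3 K q = 0"
proof -
  interpret S: contact_symmetry "{h. smooth_fun A (U \<inter> dom_chart (pchart A q)) h}"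
    "U \<inter> dom_chart (pchart A q)" "vderiv A E1" "vderiv A E2" "vderiv A E3"
    c123 c131 c112 c223 c231 c212 v1 v2 f
    by (rule contact_symmetry_chart[OF pchart(1)])
  have q': "q \<in> U \<inter> dom_chart (pchart A q)" using q pchart by blast
  have V: "S.V h q = - vderiv A E2 f q * vderiv A E1 h q + vderiv A E1 f q * vderiv A E2 h q
      + f q * vderiv A E3 h q" for h
    using symmetry_equations(1,2)[OF q] by (simp add: S.V_def)
  show "- vderiv A E2 f q * vderiv A E1 M q + vderiv A E1 f q * vderiv A E2 M q + f q * vderiv A E3 M q = 0"
    if "M = (\<lambda>q. ((c123 q - c231 q) / 2)\<^sup>2 + (c131 q)\<^sup>2)"
    unfolding V[symmetric] that by (rule S.V_invariant_M[OF q'])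
  show "- vderiv A E2 f q * vderiv A E1 K q + vderiv A E1 f q * vderiv A E2 K q + f q * vderiv A E3 K q = 0"
    if "K = (\<lambda>q. vderiv A E1 c212 q - vderiv A E2 c112 q + (c112 q)\<^sup>2 + (c212 q)\<^sup>2
                   - 1/2 * (c123 q + c231 q))"
    unfolding V[symmetric] that by (rule S.V_invariant_K[OF q'])
qed

lemma f_nonzero:
  assumes q: "q \<in> U" "V q \<notin> \<Delta> q"
  shows "f q \<noteq> 0"
  using q \<Delta>_eq_kernel by (simp add: f_def)

end

lemma two_linear_equations:
  fixes x y z :: real
  assumes M: "- y * m1 + x * m2 + z * m3 = 0" and K: "- y * k1 + x * k2 + z * k3 = 0"
    and "z \<noteq> 0" "k1 * m2 - k2 * m1 \<noteq> 0"
  shows "x / z = (k3 * m1 - k1 * m3) / (k1 * m2 - k2 * m1)"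
    and "y / z = (k3 * m2 - k2 * m3) / (k1 * m2 - k2 * m1)"
proof -
  have "k1 * (- y * m1 + x * m2 + z * m3) - m1 * (- y * k1 + x * k2 + z * k3) = 0"
    "k2 * (- y * m1 + x * m2 + z * m3) - m2 * (- y * k1 + x * k2 + z * k3) = 0"
    unfolding M K by simp_all
  then show "x / z = (k3 * m1 - k1 * m3) / (k1 * m2 - k2 * m1)"
    "y / z = (k3 * m2 - k2 * m3) / (k1 * m2 - k2 * m1)"
    using assms(3,4) by (simp_all add: frac_eq_eq algebra_simps)
qed

theorem theorem3:
  fixes A :: "'a::{t2_space, second_countable_topology} chart set"
    and \<Delta> :: "'a \<Rightarrow> (real^3) set"
    and ori :: "'a \<Rightarrow> ((real^3) \<times> (real^3)) set"
    and g :: "'a \<Rightarrow> real^3 \<Rightarrow> real^3 \<Rightarrow> real"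
    and p :: 'a and U :: "'a set"
    and \<eta>1 \<eta>2 \<eta>3 :: "'a form1" and E1 E2 E3 V :: "'a vfield"
    and C1_23 C1_31 C1_12 C2_23 C2_31 C2_12 M K :: "'a \<Rightarrow> real"
  assumes "sub_riemannian_surface A \<Delta> ori g" and "contact A \<Delta>"
    and "open U" and "p \<in> U"
    and "adapted_coframe_field A \<Delta> ori g U \<eta>1 \<eta>2 \<eta>3"
    and "smooth_fun A U C1_23" and "smooth_fun A U C1_31" and "smooth_fun A U C1_12"
    and "smooth_fun A U C2_23" and "smooth_fun A U C2_31" and "smooth_fun A U C2_12"
    and "\<And>q u v. q \<in> U \<Longrightarrow> ext_deriv A \<eta>1 q u v =
           C1_23 q * (\<eta>2 \<and>\<^sub>1 \<eta>3) q u v + C1_31 q * (\<eta>3 \<and>\<^sub>1 \<eta>1) q u v + C1_12 q * (\<eta>1 \<and>\<^sub>1 \<eta>2) q u v"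
    and "\<And>q u v. q \<in> U \<Longrightarrow> ext_deriv A \<eta>2 q u v =
           C2_23 q * (\<eta>2 \<and>\<^sub>1 \<eta>3) q u v + C2_31 q * (\<eta>3 \<and>\<^sub>1 \<eta>1) q u v + C2_12 q * (\<eta>1 \<and>\<^sub>1 \<eta>2) q u v"
    and "\<And>q u v. q \<in> U \<Longrightarrow> ext_deriv A \<eta>3 q u v = (\<eta>1 \<and>\<^sub>1 \<eta>2) q u v"
    and "dual_frame_field A U \<eta>1 \<eta>2 \<eta>3 E1 E2 E3"
    and "M = (\<lambda>q. ((C1_23 q - C2_31 q) / 2)\<^sup>2 + (C1_31 q)\<^sup>2)"
    and "K = (\<lambda>q. vderiv A E1 C2_12 q - vderiv A E2 C1_12 q + (C1_12 q)\<^sup>2 + (C2_12 q)\<^sup>2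
                   - 1/2 * (C1_23 q + C2_31 q))"
    and "infinitesimal_symmetry A \<Delta> g V"
  shows
    "(\<exists>!f. f \<in> extensional U \<and> smooth_fun A U f \<and>
        (\<forall>q\<in>U. V q = - vderiv A E2 f q *\<^sub>R E1 q + vderiv A E1 f q *\<^sub>R E2 q + f q *\<^sub>R E3 q \<and>
                 vderiv A E3 f q = 0)) \<and>
     (\<forall>f. smooth_fun A U f \<and>
        (\<forall>q\<in>U. V q = - vderiv A E2 f q *\<^sub>R E1 q + vderiv A E1 f q *\<^sub>R E2 q + f q *\<^sub>R E3 q \<and>
                 vderiv A E3 f q = 0) \<and>
        (\<forall>q\<in>U. V q \<notin> \<Delta> q) \<and>
        (\<forall>q\<in>U. vderiv A E1 K q * vderiv A E2 M q - vderiv A E2 K q * vderiv A E1 M q \<noteq> 0) \<longrightarrow>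
        (\<forall>q\<in>U. f q \<noteq> 0 \<and>
           vderiv A E1 f q / f q =
             (vderiv A E3 K q * vderiv A E1 M q - vderiv A E1 K q * vderiv A E3 M q) /
             (vderiv A E1 K q * vderiv A E2 M q - vderiv A E2 K q * vderiv A E1 M q) \<and>
           vderiv A E2 f q / f q =
             (vderiv A E3 K q * vderiv A E2 M q - vderiv A E2 K q * vderiv A E3 M q) /
             (vderiv A E1 K q * vderiv A E2 M q - vderiv A E2 K q * vderiv A E1 M q) \<and>
           vderiv A E3 f q / f q = 0))"
proof -
  interpret F: framed_symmetry A U \<eta>1 \<eta>2 \<eta>3 E1 E2 E3 C1_23 C1_31 C1_12 C2_23 C2_31 C2_12 \<Delta> ori g V
    using assms by unfold_locales (simp_all add: sub_riemannian_surface_def adapted_coframe_field_def)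
  let ?Q = "\<lambda>f. \<forall>q\<in>U. V q = - vderiv A E2 f q *\<^sub>R E1 q + vderiv A E1 f q *\<^sub>R E2 q + f q *\<^sub>R E3 q \<and>
                 vderiv A E3 f q = 0"
  have component: "h q = F.f q" if "?Q h" "q \<in> U" for h q
  proof -
    have V: "V q = - vderiv A E2 h q *\<^sub>R E1 q + vderiv A E1 h q *\<^sub>R E2 q + h q *\<^sub>R E3 q"
      using that by blast
    show ?thesis
      unfolding F.f_def V using that(2) by (simp only: F.\<eta>_linear_rules[OF that(2)] F.dual[OF that(2)])
  qed
  have restrict: "vderiv A X (restrict F.f U) q = vderiv A X F.f q" if "q \<in> U" for X q
    by (rule F.vderiv_cong[OF assms(3) that]) simp
  have "\<exists>!f. f \<in> extensional U \<and> smooth_fun A U f \<and> ?Q f"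
  proof (rule ex1I[of _ "restrict F.f U"], intro conjI)
    show "smooth_fun A U (restrict F.f U)"
      by (rule F.smooth_fun_cong[OF assms(3) F.smooth_components(3)]) simp
    show "?Q (restrict F.f U)"
      using F.V_expansion F.E3_f by (simp add: restrict)
    show "h = restrict F.f U" if "h \<in> extensional U \<and> smooth_fun A U h \<and> ?Q h" for h
      by (rule extensionalityI[of _ U]) (use that component in auto)
  qed simp
  moreover have "f q \<noteq> 0 \<and>
           vderiv A E1 f q / f q =
             (vderiv A E3 K q * vderiv A E1 M q - vderiv A E1 K q * vderiv A E3 M q) /
             (vderiv A E1 K q * vderiv A E2 M q - vderiv A E2 K q * vderiv A E1 M q) \<and>
           vderiv A E2 f q / f q =
             (vderiv A E3 K q * vderiv A E2 M q - vderiv A E2 K q * vderiv A E3 M q) /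
             (vderiv A E1 K q * vderiv A E2 M q - vderiv A E2 K q * vderiv A E1 M q) \<and>
           vderiv A E3 f q / f q = 0"
    if f: "?Q f" and V: "V q \<notin> \<Delta> q" and q: "q \<in> U"
      and det: "vderiv A E1 K q * vderiv A E2 M q - vderiv A E2 K q * vderiv A E1 M q \<noteq> 0" for f q
  proof -
    have eq: "f q = F.f q" "\<And>X. vderiv A X f q = vderiv A X F.f q"
      using component[OF f] F.vderiv_cong[OF assms(3) q, of f F.f] q by auto
    note nz = F.f_nonzero[OF q V]
    note lin = two_linear_equations[OF F.V_M[OF q assms(16)] F.V_K[OF q assms(17)] nz]
    show ?thesis
      unfolding eq using nz lin det F.E3_f[OF q] by simp
  qed
  ultimately show ?thesis by blast
qed

end
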